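(* Let $\mathcal{P}$ be either $\mathcal{G}$ or $\mathcal{M}$, and let $X_\lambda$ be a cellular $\mathcal{P}$-multipointed $d$-space. Let $\gamma$ be an execution path of $X_\lambda$. It can be decomposed as a Moore composition \[\gamma=(\widehat{g_{\nu_1}}\delta_{z_1}\phi_1\mu_{\ell_1})*\dots*(\widehat{g_{\nu_n}}\delta_{z_n}\phi_n\mu_{\ell_n})\] with $n\geq 1$, with $\nu_i<\lambda$, $z_i\in\mathbf{D}^{n_{\nu_i}}\setminus\mathbf{S}^{n_{\nu_i}-1}$ and $\phi_i\in\mathcal{P}(1,1)$ for all $i\in\{1,\dots,n\}$, and with $\ell_1+\dots+\ell_n=1$ ($\ell_i>0$). Consider a second decomposition of this kind \[\gamma=(\widehat{g_{\nu'_1}}\delta_{z'_1}\phi'_1\mu_{\ell'_1})*\dots*(\widehat{g_{\nu'_{n'}}}\delta_{z'_{n'}}\phi'_{n'}\mu_{\ell'_{n'}}).\] Then $n=n'$, $\nu_i=\nu'_i$ and $z_i=z'_i$ for all $1\le i\le n$, and \[(\phi_1\mu_{\ell_1})\otimes\dots\otimes(\phi_n\mu_{\ell_n})=(\phi'_1\mu_{\ell'_1})\otimes\dots\otimes(\phi'_n\mu_{\ell'_n})\in\mathcal{P}(1,n).\]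
   Context: $\mathbf{Top}$ denotes either the category of $\Delta$-generated spaces (spaces whose topology is final with respect to all continuous maps from $[0,1]$) or its full subcategory of $\Delta$-Hausdorff ones (the image of every continuous map from $[0,1]$ is closed). For $\ell,\ell'>0$, $\mathcal{G}(\ell,\ell')$ (resp. $\mathcal{M}(\ell,\ell')$) is the set of nondecreasing homeomorphisms (resp. nondecreasing surjective maps) from $[0,\ell]$ to $[0,\ell']$. Let $\mathcal{P}$ be $\mathcal{G}$ or $\mathcal{M}$. Let $\mu_\ell:[0,\ell]\to[0,1]$, $\mu_\ell(t)=t/\ell$. For $\phi_i\in\mathcal{P}(\ell_i,\ell'_i)$, $\phi_1\otimes\dots\otimes\phi_n\in\mathcal{P}(\sum_i\ell_i,\sum_i\ell'_i)$ is the concatenation: $t\mapsto\phi_i(t-\sum_{j<i}\ell_j)+\sum_{j<i}\ell'_j$ for $\sum_{j<i}\ell_j\le t\le\sum_{j\le i}\ell_j$. The Moore composition of $\gamma_1:[0,\ell_1]\to U$ and $\gamma_2:[0,\ell_2]\to U$ with $\gamma_1(\ell_1)=\gamma_2(0)$ is $\gamma_1*\gamma_2:[0,\ell_1+\ell_2]\to U$ equal to $\gamma_1(t)$ on $[0,\ell_1]$ and $\gamma_2(t-\ell_1)$ on $[\ell_1,\ell_1+\ell_2]$. A $\mathcal{P}$-multipointed $d$-space is a triple $X=(|X|,X^0,\mathbb{P}^{top}X)$ with $|X|\in\mathbf{Top}$, $X^0\subset |X|$ a set (of states), and $\mathbb{P}^{top}X$ a set of continuous maps $[0,1]\to|X|$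 (execution paths) such that: $\gamma(0),\gamma(1)\in X^0$ for each execution path; $\gamma\phi$ is an execution path for each execution path $\gamma$ and each $\phi\in\mathcal{P}(1,1)$; and if $\gamma_1(1)=\gamma_2(0)$ the normalized composition ($t\mapsto\gamma_1(2t)$ for $t\le 1/2$, $t\mapsto\gamma_2(2t-1)$ for $t\geq 1/2$) is an execution path. Maps are continuous maps $|X|\to|Y|$ sending states to states and execution paths to execution paths. For $Z\in\mathbf{Top}$, $\mathrm{Glob}^{\mathcal{P}}(Z)$ is the $\mathcal{P}$-multipointed $d$-space with underlying space the quotient of $\{0,1\}\sqcup(Z\times[0,1])$ by $(z,0)=(z',0)=0$ and $(z,1)=(z',1)=1$, states $\{0,1\}$, and execution paths the maps $\delta_z\phi$ with $z\in Z$, $\phi\in\mathcal{P}(1,1)$, where $\delta_z(t)=(z,t)$. Cellular objects: let $\lambda$ be an ordinal and $(X_\nu)_{\nu\le\lambda}$ a colimit-preserving transfinite sequence of $\mathcal{P}$-multipointed $d$-spaces such that $X_0=(X^0,X^0,\varnothing)$ for a set $X^0$ (discrete) and, for each $\nu<\lambda$, $X_{\nu+1}$ is the pushout of $\mathrm{Glob}^{\mathcal{P}}(\mathbf{D}^{n_\nu})\leftarrow\mathrm{Glob}^{\mathcal{P}}(\mathbf{S}^{n_\nu-1})\xrightarrow{g_\nu}X_\nu$ with $n_\nu\ge 0$ ($\mathbf{D}^n$ the unit disk, $\mathbf{S}^{n-1}$ its boundary sphere, $\mathbf{D}^0=\{0\}$, $\mathbf{S}^{-1}=\varnothing$); write $\widehat{g_\nu}:\mathrm{Glob}^{\mathcal{P}}(\mathbf{D}^{n_\nu})\to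 X_{\nu+1}\to X_\lambda$. Then $X_\lambda$ is called a cellular $\mathcal{P}$-multipointed $d$-space. *)

theory Defs
  imports "HOL-Analysis.Analysis"
begin

section \<open>The two choices of category of spaces\<close>

abbreviation unit_interval :: "real topology"
  where "unit_interval \<equiv> top_of_set {0..1}"

definition delta_generated :: "'a topology \<Rightarrow> bool"
  where "delta_generated X \<longleftrightarrow>
    (\<forall>U. U \<subseteq> topspace X \<and> (\<forall>p. pathin X p \<longrightarrow> openin unit_interval {t \<in> {0..1}. p t \<in> U})
      \<longrightarrow> openin X U)"

definition delta_Hausdorff :: "'a topology \<Rightarrow> bool"
  where "delta_Hausdorff X \<longleftrightarrow> (\<forall>p. pathin X p \<longrightarrow> closedin X (p ` {0..1}))"

datatype top_cat = Delta_Gen | Delta_Gen_Hausdorff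

fun in_top :: "top_cat \<Rightarrow> 'a topology \<Rightarrow> bool" where
  "in_top Delta_Gen X \<longleftrightarrow> delta_generated X"
| "in_top Delta_Gen_Hausdorff X \<longleftrightarrow> delta_generated X \<and> delta_Hausdorff X"

section \<open>Reparametrizations\<close>

text \<open>
  A map with domain \<open>A\<close> is always represented by its extensional representative
  (\<open>undefined\<close> outside \<open>A\<close>), so that equality of maps is equality in HOL, and composites are
  formed with \<^const>\<open>compose\<close>.
\<close>

definition G_maps :: "real \<Rightarrow> real \<Rightarrow> (real \<Rightarrow> real) set"
  where "G_maps l l' = {\<phi> \<in> extensional {0..l}. mono_on {0..l} \<phi> \<and>
    homeomorphic_map (top_of_set {0..l}) (top_of_set {0..l'}) \<phi>}"

definition M_maps :: "real \<Rightarrow> real \<Rightarrow> (real \<Rightarrow> real) set"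
  where "M_maps l l' = {\<phi> \<in> extensional {0..l}. mono_on {0..l} \<phi> \<and> \<phi> ` {0..l} = {0..l'}}"

definition rescale :: "real \<Rightarrow> real \<Rightarrow> real"
  where "rescale l = (\<lambda>t\<in>{0..l}. t / l)"

text \<open>
  A triple \<open>(l, l', \<phi>)\<close> stands for a map from \<open>{0..l}\<close> to \<open>{0..l'}\<close>, and a pair \<open>(l, \<gamma>)\<close>
  for a path with domain \<open>{0..l}\<close>.
\<close>

definition tensor2 ::
  "real \<times> real \<times> (real \<Rightarrow> real) \<Rightarrow> real \<times> real \<times> (real \<Rightarrow> real) \<Rightarrow> real \<times> real \<times> (real \<Rightarrow> real)"
  where "tensor2 = (\<lambda>(l1, l1', \<phi>1) (l2, l2', \<phi>2).
    (l1 + l2, l1' + l2', \<lambda>t\<in>{0..l1 + l2}. if t \<le> l1 then \<phi>1 t else \<phi>2 (t - l1) + l1'))"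

text \<open>The value on the empty list is the neutral element, the map from \<open>{0..0}\<close> to itself.\<close>

fun tensor :: "(real \<times> real \<times> (real \<Rightarrow> real)) list \<Rightarrow> real \<times> real \<times> (real \<Rightarrow> real)" where
  "tensor [] = (0, 0, \<lambda>t\<in>{0..0}. 0)"
| "tensor [a] = a"
| "tensor (a # b # as) = tensor2 a (tensor (b # as))"

definition moore2 :: "real \<times> (real \<Rightarrow> 'a) \<Rightarrow> real \<times> (real \<Rightarrow> 'a) \<Rightarrow> real \<times> (real \<Rightarrow> 'a)"
  where "moore2 = (\<lambda>(l1, \<gamma>1) (l2, \<gamma>2).
    (l1 + l2, \<lambda>t\<in>{0..l1 + l2}. if t \<le> l1 then \<gamma>1 t else \<gamma>2 (t - l1)))"

text \<open>
  The Moore composition of a nonempty list; the value on the empty list is never used.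
  The composite only makes sense for composable lists.
\<close>

fun moore :: "(real \<times> (real \<Rightarrow> 'a)) list \<Rightarrow> real \<times> (real \<Rightarrow> 'a)" where
  "moore [] = undefined"
| "moore [p] = p"
| "moore (p # q # ps) = moore2 p (moore (q # ps))"

definition composable :: "(real \<times> (real \<Rightarrow> 'a)) list \<Rightarrow> bool"
  where "composable = successively (\<lambda>(l1, \<gamma>1) (l2, \<gamma>2). \<gamma>1 l1 = \<gamma>2 0)"

section \<open>Multipointed d-spaces\<close>

record 'a mdspace =
  under :: "'a topology"
  states :: "'a set"
  epaths :: "(real \<Rightarrow> 'a) set"

definition norm_comp :: "(real \<Rightarrow> 'a) \<Rightarrow> (real \<Rightarrow> 'a) \<Rightarrow> real \<Rightarrow> 'a"
  where "norm_comp \<gamma>1 \<gamma>2 = (\<lambda>t\<in>{0..1}. if t \<le> 1/2 then \<gamma>1 (2 * t) else \<gamma>2 (2 * t - 1))"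

definition is_mdspace ::
  "top_cat \<Rightarrow> (real \<Rightarrow> real \<Rightarrow> (real \<Rightarrow> real) set) \<Rightarrow> 'a mdspace \<Rightarrow> bool"
  where "is_mdspace T P X \<longleftrightarrow>
    in_top T (under X) \<and>
    states X \<subseteq> topspace (under X) \<and>
    (\<forall>\<gamma>\<in>epaths X. \<gamma> \<in> extensional {0..1} \<and> pathin (under X) \<gamma> \<and>
       \<gamma> 0 \<in> states X \<and> \<gamma> 1 \<in> states X) \<and>
    (\<forall>\<gamma>\<in>epaths X. \<forall>\<phi>\<in>P 1 1. compose {0..1} \<gamma> \<phi> \<in> epaths X) \<and>
    (\<forall>\<gamma>1\<in>epaths X. \<forall>\<gamma>2\<in>epaths X. \<gamma>1 1 = \<gamma>2 0 \<longrightarrow> norm_comp \<gamma>1 \<gamma>2 \<in> epaths X)"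

abbreviation pts :: "'a mdspace \<Rightarrow> 'a set"
  where "pts X \<equiv> topspace (under X)"

definition mdmaps :: "'a mdspace \<Rightarrow> 'b mdspace \<Rightarrow> ('a \<Rightarrow> 'b) set"
  where "mdmaps X Y = {f \<in> extensional (pts X).
    continuous_map (under X) (under Y) f \<and>
    f ` states X \<subseteq> states Y \<and>
    (\<forall>\<gamma>\<in>epaths X. compose {0..1} f \<gamma> \<in> epaths Y)}"

section \<open>Globes\<close>

text \<open>
  The points of the quotient of \<open>{0,1} \<squnion> (Z \<times> [0,1])\<close>: \<open>GSrc\<close> and \<open>GTgt\<close> are the classes of
  \<open>0\<close> and \<open>1\<close>, and \<open>GMid z t\<close>, for \<open>0 < t < 1\<close>, is the singleton class of \<open>(z, t)\<close>;
  \<open>glob_pt\<close> is the quotient map on \<open>Z \<times> [0,1]\<close>.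
\<close>

datatype 'z globe = GSrc | GTgt | GMid 'z real

definition glob_pt :: "'z \<Rightarrow> real \<Rightarrow> 'z globe"
  where "glob_pt z t = (if t = 0 then GSrc else if t = 1 then GTgt else GMid z t)"

definition glob_set :: "'z topology \<Rightarrow> 'z globe set"
  where "glob_set Z = {GSrc, GTgt} \<union> {glob_pt z t | z t. z \<in> topspace Z \<and> t \<in> {0..1}}"

text \<open>
  The quotient topology; the discrete summand \<open>{0,1}\<close> imposes no condition. The ordinary product
  with the (locally compact) unit interval is the product of \<open>\<Delta>\<close>-generated spaces.
\<close>

definition glob_top :: "'z topology \<Rightarrow> 'z globe topology"
  where "glob_top Z = topology (\<lambda>U. U \<subseteq> glob_set Z \<and>
    openin (prod_topology Z unit_interval)
      {(z, t). z \<in> topspace Z \<and> t \<in> {0..1} \<and> glob_pt z t \<in> U})"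

lemma openin_glob_top:
  "openin (glob_top Z) U \<longleftrightarrow> U \<subseteq> glob_set Z \<and>
    openin (prod_topology Z unit_interval)
      {(z, t). z \<in> topspace Z \<and> t \<in> {0..1} \<and> glob_pt z t \<in> U}"
proof -
  define pre where "pre U = {(z, t). z \<in> topspace Z \<and> t \<in> {0..1} \<and> glob_pt z t \<in> U}" for U
  have inter: "pre (U \<inter> V) = pre U \<inter> pre V" for U V by (auto simp: pre_def)
  have union: "pre (\<Union>\<K>) = (\<Union>K\<in>\<K>. pre K)" for \<K> by (auto simp: pre_def)
  have "istopology (\<lambda>U. U \<subseteq> glob_set Z \<and> openin (prod_topology Z unit_interval) (pre U))"
    unfolding istopology_def
  proof (intro conjI allI impI)
    fix U V
    assume "U \<subseteq> glob_set Z \<and> openin (prod_topology Z unit_interval) (pre U)"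
      and "V \<subseteq> glob_set Z \<and> openin (prod_topology Z unit_interval) (pre V)"
    then show "U \<inter> V \<subseteq> glob_set Z" "openin (prod_topology Z unit_interval) (pre (U \<inter> V))"
      unfolding inter by (blast, metis openin_Int)
  next
    fix \<K>
    assume "\<forall>K\<in>\<K>. K \<subseteq> glob_set Z \<and> openin (prod_topology Z unit_interval) (pre K)"
    then show "\<Union>\<K> \<subseteq> glob_set Z" "openin (prod_topology Z unit_interval) (pre (\<Union>\<K>))"
      unfolding union by (blast, metis (mono_tags, lifting) imageE openin_Union)
  qed
  then show ?thesis
    unfolding glob_top_def pre_def by (simp only: topology_inverse')
qed

lemma topspace_glob_top: "topspace (glob_top Z) = glob_set Z"
proof (rule subset_antisym)
  show "topspace (glob_top Z) \<subseteq> glob_set Z"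
    using openin_topspace[of "glob_top Z"] unfolding openin_glob_top[of Z] by (rule conjunct1)
  have "{(z, t). z \<in> topspace Z \<and> t \<in> {0..1} \<and> glob_pt z t \<in> glob_set Z}
      = topspace (prod_topology Z unit_interval)"
    by (auto simp: glob_set_def)
  then have "openin (prod_topology Z unit_interval)
      {(z, t). z \<in> topspace Z \<and> t \<in> {0..1} \<and> glob_pt z t \<in> glob_set Z}"
    by (simp only: openin_topspace)
  then have "openin (glob_top Z) (glob_set Z)"
    unfolding openin_glob_top[of Z] by (intro conjI subset_refl)
  then show "glob_set Z \<subseteq> topspace (glob_top Z)"
    by (rule openin_subset)
qed

definition delta :: "'z \<Rightarrow> real \<Rightarrow> 'z globe"
  where "delta z = (\<lambda>t\<in>{0..1}. glob_pt z t)"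

definition Glob :: "(real \<Rightarrow> real \<Rightarrow> (real \<Rightarrow> real) set) \<Rightarrow> 'z topology \<Rightarrow> 'z globe mdspace"
  where "Glob P Z = \<lparr>under = glob_top Z, states = {GSrc, GTgt},
    epaths = {compose {0..1} (delta z) \<phi> | z \<phi>. z \<in> topspace Z \<and> \<phi> \<in> P 1 1}\<rparr>"

text \<open>\<open>bsphere n\<close> is the boundary of the \<open>n\<close>-disk, of dimension \<open>n - 1\<close>; it is empty for \<open>n = 0\<close>.\<close>

definition disk :: "nat \<Rightarrow> (nat \<Rightarrow> real) topology"
  where "disk n = subtopology (Euclidean_space n) {x. (\<Sum>i<n. x i ^ 2) \<le> 1}"

definition bsphere :: "nat \<Rightarrow> (nat \<Rightarrow> real) topology"
  where "bsphere n = subtopology (Euclidean_space n) {x. (\<Sum>i<n. x i ^ 2) = 1}"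

lemma bsphere_0: "topspace (bsphere 0) = {}"
  by (simp add: bsphere_def)

lemma bsphere_Suc: "bsphere (Suc n) = nsphere n"
  by (simp add: bsphere_def nsphere_def lessThan_Suc_atMost)

definition glob_incl ::
  "(real \<Rightarrow> real \<Rightarrow> (real \<Rightarrow> real) set) \<Rightarrow> nat \<Rightarrow> (nat \<Rightarrow> real) globe \<Rightarrow> (nat \<Rightarrow> real) globe"
  where "glob_incl P n = (\<lambda>x\<in>pts (Glob P (bsphere n)). x)"

section \<open>Pushouts and colimits of chains\<close>

text \<open>
  Universal properties are tested against objects carried by subsets of one type, which is large
  enough to be equivalent to testing against all objects. For the pushout of \<open>B \<leftarrow> A \<rightarrow> C\<close> the
  type is the disjoint sum of the types of \<open>B\<close> and \<open>C\<close>: an actual pushout is a quotient of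
  \<open>B \<squnion> C\<close> as a set, hence has an isomorphic copy there (choose representatives), and so does the
  candidate \<open>D\<close>, which lives in the type of \<open>C\<close>.
\<close>

definition is_pushout ::
  "top_cat \<Rightarrow> (real \<Rightarrow> real \<Rightarrow> (real \<Rightarrow> real) set) \<Rightarrow>
   'c mdspace \<Rightarrow> 'b mdspace \<Rightarrow> 'a mdspace \<Rightarrow> 'a mdspace \<Rightarrow>
   ('c \<Rightarrow> 'b) \<Rightarrow> ('c \<Rightarrow> 'a) \<Rightarrow> ('b \<Rightarrow> 'a) \<Rightarrow> ('a \<Rightarrow> 'a) \<Rightarrow> bool"
  where "is_pushout T P A B C D f g i j \<longleftrightarrow>
    f \<in> mdmaps A B \<and> g \<in> mdmaps A C \<and> i \<in> mdmaps B D \<and> j \<in> mdmaps C D \<and>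
    compose (pts A) i f = compose (pts A) j g \<and>
    (\<forall>(E :: ('b + 'a) mdspace) u v.
       is_mdspace T P E \<and> u \<in> mdmaps B E \<and> v \<in> mdmaps C E \<and>
       compose (pts A) u f = compose (pts A) v g \<longrightarrow>
       (\<exists>!w. w \<in> mdmaps D E \<and> compose (pts B) w i = u \<and> compose (pts C) w j = v))"

text \<open>
  \<open>is_chain_colimit T P X tr \<nu>\<close>: the maps \<open>tr \<mu> \<nu> : X \<mu> \<rightarrow> X \<nu>\<close> form a colimit cocone on the
  diagram \<open>(X \<mu>)\<close> for \<open>\<mu> < \<nu>\<close>. A colimit is, as a set, a quotient of the disjoint union of the
  \<open>X \<mu>\<close>, hence has an isomorphic copy in the type \<open>'i \<times> 'a\<close>.
\<close>

definition is_chain_colimit ::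
  "top_cat \<Rightarrow> (real \<Rightarrow> real \<Rightarrow> (real \<Rightarrow> real) set) \<Rightarrow>
   ('i::wellorder \<Rightarrow> 'a mdspace) \<Rightarrow> ('i \<Rightarrow> 'i \<Rightarrow> 'a \<Rightarrow> 'a) \<Rightarrow> 'i \<Rightarrow> bool"
  where "is_chain_colimit T P X tr \<nu> \<longleftrightarrow>
    (\<forall>\<mu><\<nu>. tr \<mu> \<nu> \<in> mdmaps (X \<mu>) (X \<nu>)) \<and>
    (\<forall>\<mu> \<kappa>. \<mu> \<le> \<kappa> \<and> \<kappa> < \<nu> \<longrightarrow> compose (pts (X \<mu>)) (tr \<kappa> \<nu>) (tr \<mu> \<kappa>) = tr \<mu> \<nu>) \<and>
    (\<forall>(E :: ('i \<times> 'a) mdspace) u.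
       is_mdspace T P E \<and> (\<forall>\<mu><\<nu>. u \<mu> \<in> mdmaps (X \<mu>) E) \<and>
       (\<forall>\<mu> \<kappa>. \<mu> \<le> \<kappa> \<and> \<kappa> < \<nu> \<longrightarrow> compose (pts (X \<mu>)) (u \<kappa>) (tr \<mu> \<kappa>) = u \<mu>) \<longrightarrow>
       (\<exists>!w. w \<in> mdmaps (X \<nu>) E \<and> (\<forall>\<mu><\<nu>. compose (pts (X \<mu>)) w (tr \<mu> \<nu>) = u \<mu>)))"

section \<open>Cellular multipointed d-spaces\<close>

text \<open>
  The ordinals \<open>\<nu> \<le> \<lambda>\<close> are the elements below \<open>lam\<close> of a well-ordered type;
  \<open>osucc \<nu>\<close> is only used for \<open>\<nu> < \<lambda>\<close>.
\<close>

definition ozero :: "'i::wellorder"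
  where "ozero = (LEAST \<mu>. True)"

definition osucc :: "'i::wellorder \<Rightarrow> 'i"
  where "osucc \<nu> = (LEAST \<mu>. \<nu> < \<mu>)"

definition olimit :: "'i::wellorder \<Rightarrow> bool"
  where "olimit \<nu> \<longleftrightarrow> \<nu> \<noteq> ozero \<and> (\<forall>\<mu><\<nu>. osucc \<mu> \<noteq> \<nu>)"

text \<open>
  \<open>X\<close> is the transfinite sequence with transition maps \<open>tr\<close>; \<open>dm \<nu>\<close> is the dimension of the
  \<open>\<nu>\<close>-th cell, \<open>g \<nu>\<close> its attaching map, and \<open>h \<nu>\<close> the structure map from the globe of the disk
  into the pushout \<open>X (osucc \<nu>)\<close>.
\<close>

definition cellular ::
  "top_cat \<Rightarrow> (real \<Rightarrow> real \<Rightarrow> (real \<Rightarrow> real) set) \<Rightarrow> 'i::wellorder \<Rightarrow>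
   ('i \<Rightarrow> 'a mdspace) \<Rightarrow> ('i \<Rightarrow> 'i \<Rightarrow> 'a \<Rightarrow> 'a) \<Rightarrow> ('i \<Rightarrow> nat) \<Rightarrow>
   ('i \<Rightarrow> (nat \<Rightarrow> real) globe \<Rightarrow> 'a) \<Rightarrow> ('i \<Rightarrow> (nat \<Rightarrow> real) globe \<Rightarrow> 'a) \<Rightarrow> bool"
  where "cellular T P lam X tr dm g h \<longleftrightarrow>
    (\<forall>\<nu>\<le>lam. is_mdspace T P (X \<nu>)) \<and>
    (\<forall>\<mu> \<nu>. \<mu> \<le> \<nu> \<and> \<nu> \<le> lam \<longrightarrow> tr \<mu> \<nu> \<in> mdmaps (X \<mu>) (X \<nu>)) \<and>
    (\<forall>\<nu>\<le>lam. tr \<nu> \<nu> = (\<lambda>x\<in>pts (X \<nu>). x)) \<and>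
    (\<forall>\<mu> \<kappa> \<nu>. \<mu> \<le> \<kappa> \<and> \<kappa> \<le> \<nu> \<and> \<nu> \<le> lam \<longrightarrow>
       compose (pts (X \<mu>)) (tr \<kappa> \<nu>) (tr \<mu> \<kappa>) = tr \<mu> \<nu>) \<and>
    under (X ozero) = discrete_topology (states (X ozero)) \<and> epaths (X ozero) = {} \<and>
    (\<forall>\<nu><lam. is_pushout T P (Glob P (bsphere (dm \<nu>))) (Glob P (disk (dm \<nu>))) (X \<nu>) (X (osucc \<nu>))
       (glob_incl P (dm \<nu>)) (g \<nu>) (h \<nu>) (tr \<nu> (osucc \<nu>))) \<and>
    (\<forall>\<nu>\<le>lam. olimit \<nu> \<longrightarrow> is_chain_colimit T P X tr \<nu>)"

definition ghat ::
  "(real \<Rightarrow> real \<Rightarrow> (real \<Rightarrow> real) set) \<Rightarrow> 'i::wellorder \<Rightarrow> ('i \<Rightarrow> 'i \<Rightarrow> 'a \<Rightarrow> 'a) \<Rightarrow>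
   ('i \<Rightarrow> nat) \<Rightarrow> ('i \<Rightarrow> (nat \<Rightarrow> real) globe \<Rightarrow> 'a) \<Rightarrow> 'i \<Rightarrow> (nat \<Rightarrow> real) globe \<Rightarrow> 'a"
  where "ghat P lam tr dm h \<nu> =
    compose (pts (Glob P (disk (dm \<nu>)))) (tr (osucc \<nu>) lam) (h \<nu>)"

section \<open>Decompositions of execution paths\<close>

text \<open>
  A piece \<open>(\<nu>, z, \<phi>, l)\<close> stands for the path \<open>t \<mapsto> gh \<nu> (delta z (\<phi> (t / l)))\<close> of length \<open>l\<close>.
\<close>

record 'i piece =
  cell :: 'i
  pnt :: "nat \<Rightarrow> real"
  rep :: "real \<Rightarrow> real"
  len :: real

definition piece_path ::
  "('i \<Rightarrow> (nat \<Rightarrow> real) globe \<Rightarrow> 'a) \<Rightarrow> 'i piece \<Rightarrow> real \<times> (real \<Rightarrow> 'a)"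
  where "piece_path gh p = (len p,
    compose {0..len p} (gh (cell p))
      (compose {0..len p} (delta (pnt p)) (compose {0..len p} (rep p) (rescale (len p)))))"

definition piece_reparam :: "'i piece \<Rightarrow> real \<times> real \<times> (real \<Rightarrow> real)"
  where "piece_reparam p = (len p, 1, compose {0..len p} (rep p) (rescale (len p)))"

definition is_decomposition ::
  "(real \<Rightarrow> real \<Rightarrow> (real \<Rightarrow> real) set) \<Rightarrow> 'i::wellorder \<Rightarrow> ('i \<Rightarrow> nat) \<Rightarrow>
   ('i \<Rightarrow> (nat \<Rightarrow> real) globe \<Rightarrow> 'a) \<Rightarrow> (real \<Rightarrow> 'a) \<Rightarrow> 'i piece list \<Rightarrow> bool"
  where "is_decomposition P lam dm gh \<gamma> ps \<longleftrightarrow>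
    length ps \<ge> 1 \<and>
    (\<forall>p\<in>set ps. cell p < lam \<and>
       pnt p \<in> topspace (disk (dm (cell p))) - topspace (bsphere (dm (cell p))) \<and>
       rep p \<in> P 1 1 \<and> len p > 0) \<and>
    sum_list (map len ps) = 1 \<and>
    composable (map (piece_path gh) ps) \<and>
    moore (map (piece_path gh) ps) = (1, \<gamma>)"

definition decomposition_reparam :: "'i piece list \<Rightarrow> real \<Rightarrow> real"
  where "decomposition_reparam ps = snd (snd (tensor (map piece_reparam ps)))"

end

theory Submission
  imports Defs
begin

text \<open>
  \<^emph>\<open>The idea.\<close> A word of open cells \<open>w = (\<nu>\<^sub>1, z\<^sub>1), \<dots>, (\<nu>\<^sub>n, z\<^sub>n)\<close> whose consecutive ends match has a
  natural path of length \<open>n\<close>, which crosses the \<open>i\<close>-th cell along \<open>z\<^sub>i\<close> at unit speed on \<open>[i - 1, i]\<close>.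
  Up to the choice of the cutting times, a decomposition of \<open>\<gamma>\<close> is a word \<open>w\<close> together with a \<open>\<psi> \<in> P(1,n)\<close>
  such that \<open>\<gamma>\<close> is the natural path of \<open>w\<close> precomposed with \<open>\<psi>\<close>: the tensor of the rescaled \<open>\<phi>\<^sub>i\<close> is \<open>\<psi>\<close>, and
  conversely \<open>\<psi>\<close> is cut at times where it takes the values \<open>1, \<dots>, n - 1\<close>. The predicate \<open>traces\<close> expresses this
  relation between \<open>w\<close>, \<open>\<psi>\<close> and \<open>\<gamma>\<close>; \<open>decomposition_traces\<close> and \<open>traces_decomposition\<close> are the
  two translations. In this form both halves of the theorem become short.

  \<^emph>\<open>Existence.\<close> Paths that trace a word are closed under reparametrization (compose \<open>\<psi>\<close>) and under
  normalized composition (concatenate words). Hence the execution paths of \<open>X\<^sub>\<nu>\<close> that become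
  traceable in \<open>X\<^sub>\<lambda>\<close> and join states coming from \<open>X\<^sub>0\<close> form a sub-object of \<open>X\<^sub>\<nu>\<close> with the same underlying
  space. It receives the whole pushout or colimit cocone, by induction on \<open>\<nu>\<close>, because a path of the
  globe over a boundary point of the disk already lies in the previous stage. The universal property
  then factors the identity of \<open>X\<^sub>\<nu>\<close> through the sub-object, so that it is all of \<open>X\<^sub>\<nu>\<close>
  (\<open>all_generated\<close>).

  \<^emph>\<open>Uniqueness.\<close> The points \<open>(z, t)\<close> of different open cells, with \<open>0 < t < 1\<close>, stay pairwise distinct in
  \<open>X\<^sub>\<lambda>\<close> and differ from the states (\<open>open_cells_disjoint\<close>, \<open>globe_point_determined\<close>). Therefore the
  fractional part of \<open>\<psi> t\<close> can be read off from \<open>\<gamma> t\<close>; two parameters of the same path differ by a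
  continuous integer-valued function that vanishes at \<open>0\<close>, so they agree, and the word is then read off
  at the half-integers (\<open>traces_unique\<close>).

  The points are separated by continuous real functions, which are exactly the maps into the real
  line with all its points as states and all its paths as execution paths. The real line belongs to both
  categories of spaces, so it is an admissible test object for every universal property involved. On
  \<open>X\<^bsub>\<nu>+1\<^esub>\<close> one takes a bump function supported in the new cell and multiplied by a coordinate. Every
  continuous function on \<open>X\<^sub>\<nu>\<close> extends to \<open>X\<^sub>\<lambda>\<close> (\<open>extend_to_lam\<close>): across one cell by Tietze's theorem
  on the cylinder over the disk, and at limit stages by the universal property of the colimit.
\<close>

section \<open>Reparametrizations as monotone surjections\<close>

text \<open>
  The flag \<open>s\<close> lets one argument serve both cases: \<open>s = True\<close> gives \<open>\<G>\<close> and \<open>s = False\<close> gives \<open>\<M>\<close>.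
  Replacing the topological condition on \<open>\<G>\<close> by injectivity leaves only order-theoretic
  conditions, which restrict and glue easily.
\<close>

definition reparam :: "bool \<Rightarrow> real \<Rightarrow> real \<Rightarrow> (real \<Rightarrow> real) set"
  where "reparam s l l' = {\<phi> \<in> M_maps l l'. s \<longrightarrow> inj_on \<phi> {0..l}}"

lemma reparam_iff:
  "\<phi> \<in> reparam s l l' \<longleftrightarrow> \<phi> \<in> extensional {0..l} \<and> mono_on {0..l} \<phi> \<and> \<phi> ` {0..l} = {0..l'} \<and>
     (s \<longrightarrow> inj_on \<phi> {0..l})"
  by (auto simp: reparam_def M_maps_def)

text \<open>
  A monotone map that misses no value cannot jump. The map is prolonged with slope \<open>1\<close> on both sides
  to a monotone surjection of the real line, to which the continuity criterion for monotone maps with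
  open image applies.
\<close>

lemma continuous_on_mono_surj:
  fixes f :: "real \<Rightarrow> real"
  assumes mono: "mono_on {a..b} f" and im: "f ` {a..b} = {c..d}"
  shows "continuous_on {a..b} f"
proof (cases "a \<le> b")
  case True
  have fa: "f a = c" and fb: "f b = d" and "c \<le> d"
  proof -
    have "f a \<in> {c..d}" "f b \<in> {c..d}" using im True by auto
    then have cd: "c \<in> f ` {a..b}" "d \<in> f ` {a..b}" unfolding im by auto
    then obtain x y where "x \<in> {a..b}" "f x = c" "y \<in> {a..b}" "f y = d" by auto
    then have "f a \<le> c" "d \<le> f b"
      using True mono_onD[OF mono, of a x] mono_onD[OF mono, of y b] by auto
    then show "f a = c" "f b = d" "c \<le> d" using \<open>f a \<in> _\<close> \<open>f b \<in> _\<close> by auto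
  qed
  \<comment> \<open>constant slope \<open>1\<close> outside the interval makes \<open>F\<close> surjective onto the reals\<close>
  define F where "F x = f (max a (min b x)) + (x - max a (min b x))" for x
  have "mono F"
  proof (rule monoI)
    fix x y :: real assume "x \<le> y"
    then have "f (max a (min b x)) \<le> f (max a (min b y))"
      using True by (intro mono_onD[OF mono]) auto
    moreover have "x - max a (min b x) \<le> y - max a (min b y)" using \<open>x \<le> y\<close> True by auto
    ultimately show "F x \<le> F y" unfolding F_def by linarith
  qed
  have "y \<in> range F" for y
  proof -
    consider "y < c" | "y > d" | "y \<in> {c..d}" by fastforce
    then show ?thesis
    proof cases
      case 1
      then have "F (a + (y - c)) = y" using True fa by (simp add: F_def)
      then show ?thesis by (metis rangeI)
    next
      case 2
      then have "F (b + (y - d)) = y" using True fb by (simp add: F_def)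
      then show ?thesis by (metis rangeI)
    next
      case 3
      then obtain x where "x \<in> {a..b}" "f x = y" using im by (metis imageE)
      then have "F x = y" by (simp add: F_def)
      then show ?thesis by (metis rangeI)
    qed
  qed
  then have "F ` UNIV = UNIV" by auto
  then have "continuous_on UNIV F"
    using \<open>mono F\<close> by (intro continuous_onI_mono) (auto simp: monoD)
  then have "continuous_on {a..b} F" by (rule continuous_on_subset) auto
  then show ?thesis by (rule continuous_on_eq) (auto simp: F_def)
qed auto

lemma reparam_continuous: "\<phi> \<in> reparam s l l' \<Longrightarrow> continuous_on {0..l} \<phi>"
  by (auto simp: reparam_iff intro: continuous_on_mono_surj)

text \<open>
  A monotone bijection of compact intervals is automatically continuous, and a continuous bijection
  from a compact to a Hausdorff space is a homeomorphism.
\<close>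

lemma G_maps_eq_reparam: "G_maps = reparam True"
proof (intro ext set_eqI)
  fix l l' \<phi>
  show "\<phi> \<in> G_maps l l' \<longleftrightarrow> \<phi> \<in> reparam True l l'"
  proof
    assume "\<phi> \<in> G_maps l l'"
    then show "\<phi> \<in> reparam True l l'"
      by (auto simp: G_maps_def reparam_iff homeomorphic_eq_everything_map)
  next
    assume \<phi>: "\<phi> \<in> reparam True l l'"
    then have "continuous_map (top_of_set {0..l}) (top_of_set {0..l'}) \<phi>"
      using reparam_continuous[OF \<phi>] by (auto simp: reparam_iff)
    then have "homeomorphic_map (top_of_set {0..l}) (top_of_set {0..l'}) \<phi>"
      using \<phi> by (intro continuous_imp_homeomorphic_map)
        (auto simp: reparam_iff compact_space_subtopology Hausdorff_space_subtopology)
    then show "\<phi> \<in> G_maps l l'"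
      using \<phi> by (auto simp: G_maps_def reparam_iff)
  qed
qed

lemma M_maps_eq_reparam: "M_maps = reparam False"
  by (simp add: fun_eq_iff reparam_def)

lemma reparam_endpoints:
  assumes \<phi>: "\<phi> \<in> reparam s l l'" and l: "0 \<le> l"
  shows "\<phi> 0 = 0" "\<phi> l = l'" "0 \<le> l'"
proof -
  have mono: "mono_on {0..l} \<phi>" and im: "\<phi> ` {0..l} = {0..l'}" using \<phi> by (auto simp: reparam_iff)
  have "\<phi> 0 \<in> {0..l'}" "\<phi> l \<in> {0..l'}" using im l by auto
  then have "0 \<in> \<phi> ` {0..l}" "l' \<in> \<phi> ` {0..l}" unfolding im by auto
  then obtain x y where "x \<in> {0..l}" "\<phi> x = 0" "y \<in> {0..l}" "\<phi> y = l'" by auto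
  then have "\<phi> 0 \<le> 0" "l' \<le> \<phi> l"
    using l mono_onD[OF mono, of 0 x] mono_onD[OF mono, of y l] by auto
  then show "\<phi> 0 = 0" "\<phi> l = l'" "0 \<le> l'"
    using \<open>\<phi> 0 \<in> _\<close> \<open>\<phi> l \<in> _\<close> by auto
qed

lemma reparam_range: "\<phi> \<in> reparam s l l' \<Longrightarrow> t \<in> {0..l} \<Longrightarrow> \<phi> t \<in> {0..l'}"
  by (auto simp: reparam_iff)

lemma reparam_mono: "\<phi> \<in> reparam s l l' \<Longrightarrow> 0 \<le> x \<Longrightarrow> x \<le> y \<Longrightarrow> y \<le> l \<Longrightarrow> \<phi> x \<le> \<phi> y"
  using mono_onD[of "{0..l}" \<phi> x y] by (auto simp: reparam_iff)

lemma reparam_compose: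
  assumes "\<phi> \<in> reparam s a b" "\<psi> \<in> reparam s b c"
  shows "compose {0..a} \<psi> \<phi> \<in> reparam s a c"
  unfolding reparam_iff
proof (intro conjI impI)
  show "mono_on {0..a} (compose {0..a} \<psi> \<phi>)"
  proof (rule mono_onI)
    fix x y assume xy: "x \<in> {0..a}" "y \<in> {0..a}" "x \<le> y"
    have "\<psi> (\<phi> x) \<le> \<psi> (\<phi> y)"
      using xy assms(1) reparam_range[OF assms(1)] by (intro reparam_mono[OF assms(2)] reparam_mono[OF assms(1)]) auto
    then show "compose {0..a} \<psi> \<phi> x \<le> compose {0..a} \<psi> \<phi> y" using xy by (simp add: compose_eq)
  qed
  have "compose {0..a} \<psi> \<phi> ` {0..a} = \<psi> ` \<phi> ` {0..a}" by (auto simp: compose_def)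
  then show "compose {0..a} \<psi> \<phi> ` {0..a} = {0..c}" using assms by (simp add: reparam_iff)
  assume s
  then show "inj_on (compose {0..a} \<psi> \<phi>) {0..a}"
    using assms unfolding reparam_iff inj_on_def compose_def
    by (metis (no_types, lifting) image_eqI restrict_apply')
qed (auto simp: compose_def)

lemma reparam_affine:
  assumes "\<phi> \<in> reparam s a b" and "0 < k" and "0 < m"
  shows "(\<lambda>t\<in>{0..a / k}. m * \<phi> (k * t)) \<in> reparam s (a / k) (m * b)"
  unfolding reparam_iff
proof (intro conjI impI)
  have dom: "t \<in> {0..a / k} \<longleftrightarrow> k * t \<in> {0..a}" for t
    using \<open>0 < k\<close> by (auto simp: field_simps zero_le_mult_iff)
  show "mono_on {0..a / k} (\<lambda>t\<in>{0..a / k}. m * \<phi> (k * t))"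
    using dom assms(2,3) by (auto intro!: mono_onI reparam_mono[OF assms(1)])
  show "(\<lambda>t\<in>{0..a / k}. m * \<phi> (k * t)) ` {0..a / k} = {0..m * b}"
  proof (intro subset_antisym subsetI)
    fix y assume "y \<in> (\<lambda>t\<in>{0..a / k}. m * \<phi> (k * t)) ` {0..a / k}"
    then obtain t where "t \<in> {0..a/k}" "y = m * \<phi> (k * t)" by auto
    then show "y \<in> {0..m * b}" using dom reparam_range[OF assms(1), of "k * t"] \<open>0 < m\<close> by auto
  next
    fix y assume "y \<in> {0..m * b}"
    then have "y / m \<in> {0..b}" using \<open>0 < m\<close> by (auto simp: field_simps)
    then obtain t where t: "t \<in> {0..a}" "\<phi> t = y / m" using assms(1) unfolding reparam_iff by (metis imageE)
    have "t / k \<in> {0..a/k}" "k * (t / k) = t" using t dom[of "t / k"] \<open>0 < k\<close> by auto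
    then have "t / k \<in> {0..a/k}" "m * \<phi> (k * (t / k)) = y" using t \<open>0 < m\<close> by auto
    then show "y \<in> (\<lambda>t\<in>{0..a / k}. m * \<phi> (k * t)) ` {0..a / k}"
      by (intro image_eqI[of _ _ "t / k"]) auto
  qed
  assume s
  then have inj: "inj_on \<phi> {0..a}" using assms(1) by (auto simp: reparam_iff)
  show "inj_on (\<lambda>t\<in>{0..a / k}. m * \<phi> (k * t)) {0..a / k}"
  proof (rule inj_onI)
    fix x y assume "x \<in> {0..a / k}" "y \<in> {0..a / k}"
      "(\<lambda>t\<in>{0..a / k}. m * \<phi> (k * t)) x = (\<lambda>t\<in>{0..a / k}. m * \<phi> (k * t)) y"
    then have "\<phi> (k * x) = \<phi> (k * y)" "k * x \<in> {0..a}" "k * y \<in> {0..a}" using dom \<open>0 < m\<close> by auto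
    then show "x = y" using inj_onD[OF inj] \<open>0 < k\<close> by fastforce
  qed
qed auto

lemma reparam_tensor2:
  assumes "\<phi> \<in> reparam s a b" and "\<psi> \<in> reparam s a' b'" and "0 \<le> a" "0 \<le> a'"
  shows "(\<lambda>t\<in>{0..a + a'}. if t \<le> a then \<phi> t else \<psi> (t - a) + b) \<in> reparam s (a + a') (b + b')"
proof -
  define f where "f = (\<lambda>t\<in>{0..a + a'}. if t \<le> a then \<phi> t else \<psi> (t - a) + b)"
  note e = reparam_endpoints[OF assms(1) \<open>0 \<le> a\<close>] reparam_endpoints[OF assms(2) \<open>0 \<le> a'\<close>]
  have left: "f t = \<phi> t" if "0 \<le> t" "t \<le> a" for t using that \<open>0 \<le> a'\<close> by (simp add: f_def)
  have right: "f t = \<psi> (t - a) + b" if "a \<le> t" "t \<le> a + a'" for t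
    using that e \<open>0 \<le> a\<close> by (cases "t = a") (simp_all add: f_def)
  have "mono_on {0..a + a'} f"
  proof (rule mono_onI)
    fix x y assume xy: "x \<in> {0..a + a'}" "y \<in> {0..a + a'}" "x \<le> y"
    consider "y \<le> a" | "x \<le> a" "a \<le> y" | "a \<le> x" using xy by linarith
    then show "f x \<le> f y"
    proof cases
      case 1 with xy show ?thesis
        using left[of x] left[of y] reparam_mono[OF assms(1), of x y] by auto
    next
      case 2
      then have "f x \<le> b" "b \<le> f y" using xy left[of x] right[of y]
          reparam_range[OF assms(1), of x] reparam_range[OF assms(2), of "y - a"] by auto
      then show ?thesis by linarith
    next
      case 3
      then show ?thesis using xy right[of x] right[of y]
          reparam_mono[OF assms(2), of "x - a" "y - a"] by auto
    qed
  qed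
  moreover have "f ` {0..a + a'} = {0..b + b'}"
  proof (intro subset_antisym subsetI)
    fix y assume "y \<in> f ` {0..a + a'}"
    then obtain t where "t \<in> {0..a + a'}" "y = f t" by blast
    then show "y \<in> {0..b + b'}"
      using e reparam_range[OF assms(1), of t] reparam_range[OF assms(2), of "t - a"] by (cases "t \<le> a") (auto simp: left right)
  next
    fix y assume y: "y \<in> {0..b + b'}"
    show "y \<in> f ` {0..a + a'}"
    proof (cases "y \<le> b")
      case True
      then obtain t where t: "t \<in> {0..a}" "\<phi> t = y" using y assms(1) unfolding reparam_iff
        by (metis atLeastAtMost_iff imageE)
      then have "f t = y" using left[of t] by auto
      then show ?thesis using t \<open>0 \<le> a'\<close> by (intro image_eqI[of _ _ t]) auto
    next
      case False
      then obtain t where t: "t \<in> {0..a'}" "\<psi> t = y - b" using y assms(2) unfolding reparam_iff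
        by (metis add_diff_cancel_left' atLeastAtMost_iff diff_ge_0_iff_ge diff_right_mono imageE linear)
      then have "f (a + t) = y" using right[of "a + t"] by auto
      then show ?thesis using t \<open>0 \<le> a\<close> by (intro image_eqI[of _ _ "a + t"]) auto
    qed
  qed
  moreover have "inj_on f {0..a + a'}" if s
  proof -
    have inj: "inj_on \<phi> {0..a}" "inj_on \<psi> {0..a'}" using assms \<open>s\<close> by (auto simp: reparam_iff)
    have eq: "x = y" if "f x = f y" "x \<le> y" "x \<in> {0..a + a'}" "y \<in> {0..a + a'}" for x y
    proof -
      consider "y \<le> a" | "x \<le> a" "a \<le> y" | "a \<le> x" using that by linarith
      then show ?thesis
      proof cases
        case 1
        then have "\<phi> x = \<phi> y" using that left by auto
        then show ?thesis using 1 that inj_onD[OF inj(1)] by auto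
      next
        case 2
        have xb: "\<phi> x = \<psi> (y - a) + b" using 2 that left[of x] right[of y] by auto
        have "\<phi> x \<le> b" "0 \<le> \<psi> (y - a)" using 2 that
            reparam_range[OF assms(1), of x] reparam_range[OF assms(2), of "y - a"] by auto
        then have "\<phi> x = \<phi> a" "\<psi> (y - a) = \<psi> 0" using xb e by auto
        then have "x = a" "y - a = 0" using 2 that inj_onD[OF inj(1), of x a] inj_onD[OF inj(2), of "y - a" 0] \<open>0 \<le> a\<close> \<open>0 \<le> a'\<close> by auto
        then show ?thesis by auto
      next
        case 3
        then have "\<psi> (x - a) = \<psi> (y - a)" using that right by auto
        then show ?thesis using 3 that inj_onD[OF inj(2), of "x - a" "y - a"] by auto
      qed
    qed
    show ?thesis
      by (rule inj_onI) (metis eq linear)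
  qed
  moreover have "f \<in> extensional {0..a + a'}" by (simp add: f_def)
  ultimately show ?thesis unfolding f_def reparam_iff by blast
qed

text \<open>
  With its right-hand companion, this cuts a reparametrization of a path along several cells into
  reparametrizations of the single cells. Surjectivity of the restriction is the intermediate value theorem.
\<close>

lemma reparam_restrict_left:
  assumes "\<psi> \<in> reparam s l n" and c: "0 \<le> c" "c \<le> l"
  shows "(\<lambda>t\<in>{0..c}. \<psi> t) \<in> reparam s c (\<psi> c)"
  unfolding reparam_iff
proof (intro conjI impI)
  have "0 \<le> l" using c by simp
  note e = reparam_endpoints[OF assms(1) this]
  have "continuous_on {0..c} \<psi>" using reparam_continuous[OF assms(1)] c by (auto elim: continuous_on_subset)
  have "restrict \<psi> {0..c} ` {0..c} = \<psi> ` {0..c}" by auto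
  also have "\<dots> = {0..\<psi> c}"
  proof (intro subset_antisym subsetI)
    fix y assume "y \<in> {0..\<psi> c}"
    then have "\<exists>x\<ge>0. x \<le> c \<and> \<psi> x = y"
      using e c \<open>continuous_on {0..c} \<psi>\<close> by (intro IVT') auto
    then show "y \<in> \<psi> ` {0..c}" by auto
  next
    fix y assume "y \<in> \<psi> ` {0..c}"
    then obtain t where t: "t \<in> {0..c}" "y = \<psi> t" by auto
    then show "y \<in> {0..\<psi> c}"
      using c reparam_range[OF assms(1), of t] reparam_mono[OF assms(1), of t c] by auto
  qed
  finally show "restrict \<psi> {0..c} ` {0..c} = {0..\<psi> c}" .
  show "mono_on {0..c} (restrict \<psi> {0..c})"
    using c by (intro mono_onI) (simp add: reparam_mono[OF assms(1)])
  assume s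
  then have "inj_on \<psi> {0..l}" using assms(1) by (simp add: reparam_iff)
  then have "inj_on \<psi> {0..c}" by (rule inj_on_subset) (use c in auto)
  then show "inj_on (restrict \<psi> {0..c}) {0..c}" by simp
qed auto

lemma reparam_restrict_right:
  assumes "\<psi> \<in> reparam s l n" and c: "0 \<le> c" "c \<le> l"
  shows "(\<lambda>t\<in>{0..l - c}. \<psi> (t + c) - \<psi> c) \<in> reparam s (l - c) (n - \<psi> c)"
  unfolding reparam_iff
proof (intro conjI impI)
  have "0 \<le> l" using c by simp
  note e = reparam_endpoints[OF assms(1) this]
  have "continuous_on {c..l} \<psi>" using reparam_continuous[OF assms(1)] c by (auto elim: continuous_on_subset)
  show "(\<lambda>t\<in>{0..l - c}. \<psi> (t + c) - \<psi> c) ` {0..l - c} = {0..n - \<psi> c}"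
  proof (intro subset_antisym subsetI)
    fix y assume "y \<in> {0..n - \<psi> c}"
    then have "\<exists>x\<ge>c. x \<le> l \<and> \<psi> x = y + \<psi> c"
      using e c \<open>continuous_on {c..l} \<psi>\<close> by (intro IVT') auto
    then obtain x where "c \<le> x" "x \<le> l" "\<psi> x = y + \<psi> c" by auto
    then show "y \<in> (\<lambda>t\<in>{0..l - c}. \<psi> (t + c) - \<psi> c) ` {0..l - c}"
      by (intro image_eqI[of _ _ "x - c"]) auto
  next
    fix y assume "y \<in> (\<lambda>t\<in>{0..l - c}. \<psi> (t + c) - \<psi> c) ` {0..l - c}"
    then obtain t where t: "t \<in> {0..l - c}" "y = \<psi> (t + c) - \<psi> c" by auto
    then show "y \<in> {0..n - \<psi> c}"
      using c reparam_range[OF assms(1), of "t + c"] reparam_mono[OF assms(1), of c "t + c"] by auto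
  qed
  show "mono_on {0..l - c} (\<lambda>t\<in>{0..l - c}. \<psi> (t + c) - \<psi> c)"
    using c by (intro mono_onI) (simp add: reparam_mono[OF assms(1)])
  assume s
  then have "inj_on \<psi> {0..l}" using assms(1) by (simp add: reparam_iff)
  then show "inj_on (\<lambda>t\<in>{0..l - c}. \<psi> (t + c) - \<psi> c) {0..l - c}"
    using c by (intro inj_onI) (auto dest!: inj_onD)
qed auto

section \<open>Paths that trace a word of cells\<close>

definition open_cells :: "'i::wellorder \<Rightarrow> ('i \<Rightarrow> nat) \<Rightarrow> ('i \<times> (nat \<Rightarrow> real)) set"
  where "open_cells lam dm =
    {(\<nu>, z). \<nu> < lam \<and> z \<in> topspace (disk (dm \<nu>)) - topspace (bsphere (dm \<nu>))}"

text \<open>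
  The parameter \<open>\<psi>\<close> runs through \<open>[0, n]\<close>; while \<open>\<psi> t\<close> is in \<open>[i, i + 1]\<close>, the path \<open>\<gamma>\<close> is in the \<open>i\<close>-th
  cell of the word (counted from \<open>0\<close>). The closed intervals overlap, so the condition at an integer value of \<open>\<psi>\<close>
  includes that the end of one cell is the start of the next.
\<close>

definition traces ::
  "('i \<Rightarrow> 'z globe \<Rightarrow> 'a) \<Rightarrow> ('i \<times> 'z) list \<Rightarrow> real \<Rightarrow> (real \<Rightarrow> real) \<Rightarrow> (real \<Rightarrow> 'a) \<Rightarrow> bool"
  where "traces gh ws l \<psi> \<gamma> \<longleftrightarrow> (\<forall>t\<in>{0..l}. \<forall>i<length ws.
    real i \<le> \<psi> t \<and> \<psi> t \<le> real i + 1 \<longrightarrow>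
      \<gamma> t = gh (fst (ws ! i)) (glob_pt (snd (ws ! i)) (\<psi> t - real i)))"

lemma tracesD:
  "traces gh ws l \<psi> \<gamma> \<Longrightarrow> 0 \<le> t \<Longrightarrow> t \<le> l \<Longrightarrow> i < length ws \<Longrightarrow> real i \<le> \<psi> t \<Longrightarrow> \<psi> t \<le> real i + 1 \<Longrightarrow>
    \<gamma> t = gh (fst (ws ! i)) (glob_pt (snd (ws ! i)) (\<psi> t - real i))"
  by (simp add: traces_def)

lemma traces_compose:
  assumes "traces gh ws b \<psi> \<gamma>" and "\<phi> \<in> reparam s a b"
  shows "traces gh ws a (compose {0..a} \<psi> \<phi>) (compose {0..a} \<gamma> \<phi>)"
  using assms reparam_range[OF assms(2)] by (auto simp: traces_def compose_def)

text \<open>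
  At the junction value the parameter lies both in the last cell of the first word and in the first
  cell of the second one, and without injectivity it may rest there for a while before and after the
  junction time. The two words give the same point there because \<open>\<gamma> l = \<gamma>' 0\<close>.
\<close>

lemma traces_append:
  assumes tr: "traces gh ws l \<psi> \<gamma>" "traces gh ws' l' \<psi>' \<gamma>'"
    and re: "\<psi> \<in> reparam s l (length ws)" "\<psi>' \<in> reparam s l' (length ws')"
    and ne: "ws \<noteq> []" "ws' \<noteq> []" and l: "0 \<le> l" "0 \<le> l'" and eq: "\<gamma> l = \<gamma>' 0"
  shows "traces gh (ws @ ws') (l + l')
    (\<lambda>t\<in>{0..l + l'}. if t \<le> l then \<psi> t else \<psi>' (t - l) + length ws)
    (\<lambda>t\<in>{0..l + l'}. if t \<le> l then \<gamma> t else \<gamma>' (t - l))"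
  unfolding traces_def
proof (intro ballI allI impI)
  fix t i
  let ?\<psi> = "\<lambda>t\<in>{0..l + l'}. if t \<le> l then \<psi> t else \<psi>' (t - l) + length ws"
  let ?\<gamma> = "\<lambda>t\<in>{0..l + l'}. if t \<le> l then \<gamma> t else \<gamma>' (t - l)"
  let ?g = "\<lambda>ws i x. gh (fst (ws ! i)) (glob_pt (snd (ws ! i)) x)"
  assume t: "t \<in> {0..l + l'}" and i: "i < length (ws @ ws')"
    and b: "real i \<le> ?\<psi> t \<and> ?\<psi> t \<le> real i + 1"
  define n where "n = length ws"
  have n: "0 < n" "n - 1 < length ws" "real (n - 1) = real n - 1"
    using ne by (auto simp: n_def Suc_leI of_nat_diff)
  note e = reparam_endpoints[OF re(1) l(1)] reparam_endpoints[OF re(2) l(2)]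
  \<comment> \<open>the junction point, seen from the first and from the second word\<close>
  have start: "\<gamma>' 0 = ?g ws' 0 0"
    using tracesD[OF tr(2), of 0 0] e l ne by simp
  have stop: "\<gamma> l = ?g ws (n - 1) 1"
    using tracesD[OF tr(1), of l "n - 1"] e l n by (simp add: n_def)
  show "?\<gamma> t = ?g (ws @ ws') i (?\<psi> t - real i)"
  proof (cases "t \<le> l")
    case True
    then have v: "?\<psi> t = \<psi> t" "?\<gamma> t = \<gamma> t" using t by auto
    have le: "\<psi> t \<le> n" using reparam_range[OF re(1), of t] True t by (simp add: n_def)
    show ?thesis
    proof (cases "i < n")
      case i: True
      then show ?thesis using tracesD[OF tr(1), of t i] b True t
        unfolding v by (simp add: nth_append n_def)
    next
      case False
      then have "real n \<le> real i" by simp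
      then have *: "\<psi> t = n" "real i = n" using le b unfolding v by linarith+
      then have "\<gamma> t = ?g ws (n - 1) 1"
        using tracesD[OF tr(1), of t "n - 1"] True t n by simp
      then have "\<gamma> t = ?g ws' 0 0" using stop start eq by simp
      moreover have "i = n" using * by simp
      ultimately show ?thesis unfolding v * by (simp add: nth_append n_def)
    qed
  next
    case False
    then have v: "?\<psi> t = \<psi>' (t - l) + n" "?\<gamma> t = \<gamma>' (t - l)" using t by (auto simp: n_def)
    have ge: "0 \<le> \<psi>' (t - l)" using reparam_range[OF re(2), of "t - l"] False t by simp
    show ?thesis
    proof (cases "i < n")
      case True
      then have "real i + 1 \<le> real n" by linarith
      then have *: "\<psi>' (t - l) = 0" "real i = real n - 1" using ge b unfolding v by linarith+
      then have "\<gamma>' (t - l) = ?g ws' 0 0"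
        using tracesD[OF tr(2), of "t - l" 0] False t ne by simp
      then have "\<gamma>' (t - l) = ?g ws (n - 1) 1" using stop start eq by simp
      moreover have "i = n - 1" using *(2) n by linarith
      ultimately show ?thesis unfolding v * using True by (simp add: nth_append n_def)
    next
      case i': False
      then have r: "real (i - n) = real i - real n" by (simp add: of_nat_diff)
      have "i - n < length ws'" using i i' by (simp add: n_def)
      moreover have "real (i - n) \<le> \<psi>' (t - l)" "\<psi>' (t - l) \<le> real (i - n) + 1"
        using b unfolding v r by linarith+
      ultimately have "\<gamma>' (t - l) = ?g ws' (i - n) (\<psi>' (t - l) - real (i - n))"
        using False t by (intro tracesD[OF tr(2)]) auto
      moreover have "\<psi>' (t - l) + real n - real i = \<psi>' (t - l) - real (i - n)" unfolding r by simp
      moreover have "(ws @ ws') ! i = ws' ! (i - n)" using i' by (simp add: nth_append n_def)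
      ultimately show ?thesis unfolding v by (simp only:)
    qed
  qed
qed

lemma rescale_reparam: "0 < l \<Longrightarrow> rescale l \<in> reparam s l 1"
  unfolding rescale_def
proof -
  assume l: "0 < l"
  have "(\<lambda>t\<in>{0..1}. t) \<in> reparam s 1 1" by (auto simp: reparam_iff intro!: mono_onI)
  from reparam_affine[OF this, of "1/l" 1] l
  have "(\<lambda>t\<in>{0..l}. (\<lambda>t\<in>{0..1}. t) (t / l)) \<in> reparam s l 1" by simp
  moreover have "(\<lambda>t\<in>{0..l}. (\<lambda>t\<in>{0..1}. t) (t / l)) = (\<lambda>t\<in>{0..l}. t / l)"
    using l by (intro restrict_ext) (auto simp: field_simps)
  ultimately show "(\<lambda>t\<in>{0..l}. t / l) \<in> reparam s l 1" by simp
qed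

lemma fst_moore: "qs \<noteq> [] \<Longrightarrow> fst (moore qs) = sum_list (map fst qs)"
  by (induction qs rule: moore.induct) (auto simp: moore2_def split: prod.split)

text \<open>
  In the induction over a list of pieces, this turns composability of the first piece with the second one
  into composability with the Moore composite of all remaining ones.
\<close>

lemma moore_start:
  "qs \<noteq> [] \<Longrightarrow> \<forall>q\<in>set qs. 0 \<le> fst q \<Longrightarrow> snd (moore qs) 0 = snd (hd qs) 0"
proof (induction qs rule: moore.induct)
  case (3 p q ps)
  have "0 \<le> fst (moore (q # ps))"
    using 3(3) by (subst fst_moore) (auto intro!: add_nonneg_nonneg sum_list_nonneg)
  then show ?case using 3(3) by (auto simp: moore2_def split: prod.splits)
qed auto

abbreviation letter :: "'i piece \<Rightarrow> 'i \<times> (nat \<Rightarrow> real)"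
  where "letter p \<equiv> (cell p, pnt p)"

lemma piece_traces:
  assumes "rep p \<in> reparam s 1 1" and "0 < len p"
  shows "traces gh [letter p] (len p) (snd (snd (piece_reparam p))) (snd (piece_path gh p))"
proof -
  have "t / len p \<in> {0..1}" if "t \<in> {0..len p}" for t
    using that assms(2) by (auto simp: field_simps)
  moreover have "rep p x \<in> {0..1}" if "x \<in> {0..1}" for x using reparam_range[OF assms(1) that] .
  ultimately show ?thesis
    by (auto simp: traces_def piece_path_def piece_reparam_def compose_def delta_def rescale_def)
qed

lemma fst_piece_path [simp]: "fst (piece_path gh p) = len p"
  by (simp add: piece_path_def)

lemma composable_Cons:
  "composable (p # q # qs) \<longleftrightarrow> snd p (fst p) = snd q 0 \<and> composable (q # qs)"
  by (cases p; cases q) (simp add: composable_def)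

text \<open>
  Gluing the pieces one by one: the tensor of the reparametrizations is the parameter traced by the
  Moore composite.
\<close>

lemma decomposition_traces:
  assumes "ps \<noteq> []" "\<forall>p\<in>set ps. rep p \<in> reparam s 1 1 \<and> len p > 0"
    and "composable (map (piece_path gh) ps)"
  shows "\<exists>\<psi> \<gamma>. tensor (map piece_reparam ps) = (sum_list (map len ps), real (length ps), \<psi>) \<and>
    moore (map (piece_path gh) ps) = (sum_list (map len ps), \<gamma>) \<and>
    \<psi> \<in> reparam s (sum_list (map len ps)) (length ps) \<and>
    traces gh (map letter ps) (sum_list (map len ps)) \<psi> \<gamma>"
  using assms
proof (induction ps rule: list_nonempty_induct)
  case (single p)
  then have "snd (snd (piece_reparam p)) \<in> reparam s (len p) 1"
    unfolding piece_reparam_def by (auto intro: reparam_compose rescale_reparam)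
  then show ?case
    using single piece_traces[of p s gh] by (auto simp: piece_reparam_def piece_path_def)
next
  case (cons p ps)
  let ?L = "sum_list (map len ps)" and ?\<psi>1 = "snd (snd (piece_reparam p))"
    and ?\<gamma>1 = "snd (piece_path gh p)"
  obtain q qs where ps: "ps = q # qs" using cons.hyps by (cases ps) auto
  have comp: "composable (map (piece_path gh) ps)" and link: "?\<gamma>1 (len p) = snd (piece_path gh q) 0"
    using cons.prems unfolding ps by (auto simp: composable_Cons)
  obtain \<psi> \<gamma> where IH: "tensor (map piece_reparam ps) = (?L, real (length ps), \<psi>)"
    "moore (map (piece_path gh) ps) = (?L, \<gamma>)" "\<psi> \<in> reparam s ?L (length ps)"
    "traces gh (map letter ps) ?L \<psi> \<gamma>"
    using cons.IH cons.prems comp by auto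
  have p: "rep p \<in> reparam s 1 1" "0 < len p" using cons.prems by auto
  have L: "0 \<le> ?L" using cons.prems by (intro sum_list_nonneg) (auto intro: less_imp_le)
  have "snd (moore (map (piece_path gh) ps)) 0 = snd (hd (map (piece_path gh) ps)) 0"
    using cons.prems cons.hyps
    by (intro moore_start) (auto simp: piece_path_def intro: less_imp_le)
  then have eq: "?\<gamma>1 (len p) = \<gamma> 0" using link IH(2) unfolding ps by simp
  have \<psi>1: "?\<psi>1 \<in> reparam s (len p) 1"
    using p unfolding piece_reparam_def by (auto intro: reparam_compose rescale_reparam)
  let ?\<psi> = "\<lambda>t\<in>{0..len p + ?L}. if t \<le> len p then ?\<psi>1 t else \<psi> (t - len p) + 1"
  let ?\<gamma> = "\<lambda>t\<in>{0..len p + ?L}. if t \<le> len p then ?\<gamma>1 t else \<gamma> (t - len p)"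
  have "traces gh ([letter p] @ map letter ps) (len p + ?L) ?\<psi> ?\<gamma>"
  proof -
    have one: "real (length [letter p]) = 1" by simp
    have "?\<psi>1 \<in> reparam s (len p) (length [letter p])" using \<psi>1 unfolding one .
    moreover have "\<psi> \<in> reparam s ?L (length (map letter ps))" using IH(3) by simp
    ultimately show ?thesis
      using traces_append[OF piece_traces[OF p, of gh] IH(4), of s] cons.hyps L p eq
      unfolding one by simp
  qed
  moreover have "?\<psi> \<in> reparam s (len p + ?L) (1 + real (length ps))"
    using reparam_tensor2[OF \<psi>1 IH(3)] p L by simp
  moreover have "tensor (map piece_reparam (p # ps)) = (len p + ?L, 1 + real (length ps), ?\<psi>)"
  proof -
    have "tensor (map piece_reparam (p # ps)) = tensor2 (piece_reparam p) (tensor (map piece_reparam ps))"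
      by (simp add: ps)
    moreover have "fst (piece_reparam p) = len p" "fst (snd (piece_reparam p)) = 1"
      by (simp_all add: piece_reparam_def)
    ultimately show ?thesis unfolding IH(1) tensor2_def case_prod_beta by (simp cong: if_cong)
  qed
  moreover have "moore (map (piece_path gh) (p # ps)) = (len p + ?L, ?\<gamma>)"
  proof -
    have "moore (map (piece_path gh) (p # ps)) = moore2 (piece_path gh p) (moore (map (piece_path gh) ps))"
      by (simp add: ps)
    then show ?thesis unfolding IH(2) moore2_def case_prod_beta by (simp cong: if_cong)
  qed
  ultimately show ?case by (simp add: add.commute)
qed

lemma traces_single_piece:
  assumes "traces gh [w] L \<psi> \<gamma>" and "\<psi> \<in> reparam s L 1" and "0 < L"
  shows "\<exists>p. letter p = w \<and> rep p \<in> reparam s 1 1 \<and> len p = L \<and>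
    piece_path gh p = (L, restrict \<gamma> {0..L})"
proof -
  let ?p = "\<lparr>cell = fst w, pnt = snd w, rep = (\<lambda>t\<in>{0..1}. \<psi> (L * t)), len = L\<rparr>"
  have "rep ?p \<in> reparam s 1 1"
    using reparam_affine[OF assms(2) \<open>0 < L\<close>, of 1] \<open>0 < L\<close> by simp
  moreover have "piece_path gh ?p = (L, restrict \<gamma> {0..L})"
  proof -
    have "gh (fst w) (glob_pt (snd w) (\<psi> t)) = \<gamma> t" "\<psi> t \<in> {0..1}" "t / L \<in> {0..1}"
      if "t \<in> {0..L}" for t
      using that reparam_range[OF assms(2) that] tracesD[OF assms(1), of t 0] \<open>0 < L\<close> by auto
    then show ?thesis
      using \<open>0 < L\<close> by (auto simp: piece_path_def compose_def delta_def rescale_def fun_eq_iff)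
  qed
  ultimately show ?thesis by (intro exI[of _ ?p]) simp
qed

text \<open>
  Conversely, a traced word is cut into pieces from left to right. The first cut is at a time \<open>c\<close> where the
  parameter takes the value \<open>1\<close>; for non-injective reparametrizations the choice of \<open>c\<close>, and hence of the
  lengths, is not unique.
\<close>

lemma traces_decomposition:
  assumes "ws \<noteq> []" and "traces gh ws L \<psi> \<gamma>" and "\<psi> \<in> reparam s L (length ws)"
    and "0 < L" and "\<gamma> \<in> extensional {0..L}"
  shows "\<exists>ps. map letter ps = ws \<and> (\<forall>p\<in>set ps. rep p \<in> reparam s 1 1 \<and> len p > 0) \<and>
    sum_list (map len ps) = L \<and> composable (map (piece_path gh) ps) \<and>
    moore (map (piece_path gh) ps) = (L, \<gamma>)"
  using assms
proof (induction ws arbitrary: L \<psi> \<gamma> rule: list_nonempty_induct)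
  case (single w)
  then obtain p where "letter p = w" "rep p \<in> reparam s 1 1" "len p = L"
    "piece_path gh p = (L, restrict \<gamma> {0..L})"
    using traces_single_piece[of gh w L \<psi> \<gamma> s] by auto
  then show ?case using single
    by (intro exI[of _ "[p]"]) (auto simp: composable_def extensional_restrict)
next
  case (cons w ws)
  note re = cons.prems(2) and tr = cons.prems(1)
  have L: "0 \<le> L" using cons.prems by simp
  note e = reparam_endpoints[OF re L]
  have n: "1 \<le> length ws" using cons.hyps by (simp add: Suc_leI)
  have "1 \<in> \<psi> ` {0..L}" using re n by (simp add: reparam_iff)
  then obtain c where c: "0 \<le> c" "c \<le> L" "\<psi> c = 1" by auto
  have "c \<noteq> 0" "c \<noteq> L" using c e n cons.hyps by auto
  then have c': "0 < c" "0 < L - c" using c by auto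
  have re1: "restrict \<psi> {0..c} \<in> reparam s c 1"
    using reparam_restrict_left[OF re c(1,2)] c by simp
  have "traces gh [w] c (restrict \<psi> {0..c}) \<gamma>"
    using tracesD[OF tr, of _ 0] c by (auto simp: traces_def)
  then obtain p where p: "letter p = w" "rep p \<in> reparam s 1 1" "len p = c"
    "piece_path gh p = (c, restrict \<gamma> {0..c})"
    using traces_single_piece[OF _ re1 \<open>0 < c\<close>] by blast
  define \<psi>' where "\<psi>' = (\<lambda>t\<in>{0..L - c}. \<psi> (t + c) - 1)"
  define \<gamma>' where "\<gamma>' = (\<lambda>t\<in>{0..L - c}. \<gamma> (t + c))"
  have re': "\<psi>' \<in> reparam s (L - c) (length ws)"
    using reparam_restrict_right[OF re c(1,2)] c by (simp add: \<psi>'_def)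
  have tr': "traces gh ws (L - c) \<psi>' \<gamma>'"
    unfolding traces_def
  proof (intro ballI allI impI)
    fix t i assume "t \<in> {0..L - c}" "i < length ws" "real i \<le> \<psi>' t \<and> \<psi>' t \<le> real i + 1"
    then show "\<gamma>' t = gh (fst (ws ! i)) (glob_pt (snd (ws ! i)) (\<psi>' t - real i))"
      using tracesD[OF tr, of "t + c" "Suc i"] c by (simp add: \<psi>'_def \<gamma>'_def algebra_simps)
  qed
  have "\<gamma>' \<in> extensional {0..L - c}" by (simp add: \<gamma>'_def)
  then obtain ps where ps: "map letter ps = ws" "\<forall>p\<in>set ps. rep p \<in> reparam s 1 1 \<and> len p > 0"
    "sum_list (map len ps) = L - c" "composable (map (piece_path gh) ps)"
    "moore (map (piece_path gh) ps) = (L - c, \<gamma>')"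
    using cons.IH[OF tr' re' c'(2)] by blast
  obtain q qs where qs: "ps = q # qs" using ps(1) cons.hyps by (cases ps) auto
  have "snd (moore (map (piece_path gh) ps)) 0 = snd (hd (map (piece_path gh) ps)) 0"
    using ps(2) by (intro moore_start) (auto simp: qs piece_path_def intro: less_imp_le)
  then have "snd (piece_path gh q) 0 = \<gamma>' 0" using ps(5) by (simp add: qs)
  also have "\<gamma>' 0 = \<gamma> c" using c' by (simp add: \<gamma>'_def)
  finally have "composable (map (piece_path gh) (p # ps))"
    using ps(4) p(4) c' by (simp add: composable_Cons qs)
  moreover have "moore (map (piece_path gh) (p # ps)) = (L, \<gamma>)"
  proof -
    have "moore (map (piece_path gh) (p # ps)) = moore2 (c, restrict \<gamma> {0..c}) (L - c, \<gamma>')"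
      using ps(5) p(4) by (simp add: qs)
    also have "\<dots> = (L, \<gamma>)"
      using c cons.prems(4) by (auto simp: moore2_def \<gamma>'_def fun_eq_iff extensional_def)
    finally show ?thesis .
  qed
  ultimately show ?case
    using p ps c' by (intro exI[of _ "p # ps"]) auto
qed

section \<open>Transport of multipointed d-spaces along injections\<close>

text \<open>
  Topological invariance of the two conditions is needed to replace a test object by a copy in
  another type.
\<close>

lemma homeomorphic_maps_delta_generated:
  assumes hom: "homeomorphic_maps X Y f g" and X: "delta_generated X"
  shows "delta_generated Y"
  unfolding delta_generated_def
proof (intro allI impI)
  have f: "continuous_map X Y f" and g: "continuous_map Y X g"
    and fg: "\<And>y. y \<in> topspace Y \<Longrightarrow> f (g y) = y"
    using hom by (auto simp: homeomorphic_maps_def)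
  fix U
  assume U: "U \<subseteq> topspace Y \<and>
    (\<forall>p. pathin Y p \<longrightarrow> openin unit_interval {t \<in> {0..1}. p t \<in> U})"
  let ?V = "{x \<in> topspace X. f x \<in> U}"
  have "openin X ?V"
    using X[unfolded delta_generated_def]
  proof (elim allE[of _ ?V] impE, intro conjI allI impI)
    fix p assume p: "pathin X p"
    then have "pathin Y (f \<circ> p)" using f by (rule pathin_compose)
    then have "openin unit_interval {t \<in> {0..1}. (f \<circ> p) t \<in> U}" using U by blast
    moreover have "{t \<in> {0..1}. (f \<circ> p) t \<in> U} = {t \<in> {0..1}. p t \<in> ?V}"
      using p by (auto simp: pathin_def continuous_map_def)
    ultimately show "openin unit_interval {t \<in> {0..1}. p t \<in> ?V}" by simp
  qed auto
  then have "openin Y {y \<in> topspace Y. g y \<in> ?V}" 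
    using g by (rule openin_continuous_map_preimage[rotated])
  moreover have "{y \<in> topspace Y. g y \<in> ?V} = U"
    using U fg g by (auto simp: continuous_map_def)
  ultimately show "openin Y U" by simp
qed

lemma homeomorphic_maps_delta_Hausdorff:
  assumes hom: "homeomorphic_maps X Y f g" and X: "delta_Hausdorff X"
  shows "delta_Hausdorff Y"
  unfolding delta_Hausdorff_def
proof (intro allI impI)
  fix p assume p: "pathin Y p"
  have g: "continuous_map Y X g" and f: "homeomorphic_map X Y f"
    and fg: "\<And>y. y \<in> topspace Y \<Longrightarrow> f (g y) = y"
    using hom by (auto simp: homeomorphic_maps_def homeomorphic_map_maps)
  have "pathin X (g \<circ> p)" using p g by (rule pathin_compose)
  then have "closedin X ((g \<circ> p) ` {0..1})" using X unfolding delta_Hausdorff_def by blast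
  then have "closedin Y (f ` (g \<circ> p) ` {0..1})"
    using f homeomorphic_map_closedness_eq by blast
  moreover have "f ` (g \<circ> p) ` {0..1} = p ` {0..1}"
    using p fg by (force simp: pathin_def continuous_map_def image_iff)
  ultimately show "closedin Y (p ` {0..1})" by simp
qed

lemma homeomorphic_maps_in_top:
  "homeomorphic_maps X Y f g \<Longrightarrow> in_top T X \<Longrightarrow> in_top T Y"
  by (cases T) (auto intro: homeomorphic_maps_delta_generated homeomorphic_maps_delta_Hausdorff)

text \<open>
  The fragment of the axioms that suffices to compose maps and to recognise real functions as maps.
  It holds for globes as well (\<open>pre_mdspace_Glob\<close>), which enter only as sources of maps.
\<close>

definition pre_mdspace :: "'a mdspace \<Rightarrow> bool"
  where "pre_mdspace X \<longleftrightarrow> states X \<subseteq> pts X \<and>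
    (\<forall>\<gamma>\<in>epaths X. \<gamma> \<in> extensional {0..1} \<and> pathin (under X) \<gamma>)"

lemma is_mdspace_pre: "is_mdspace T P X \<Longrightarrow> pre_mdspace X"
  by (auto simp: is_mdspace_def pre_mdspace_def)

lemma pathin_topspace: "pathin X p \<Longrightarrow> t \<in> {0..1} \<Longrightarrow> p t \<in> topspace X"
  by (auto simp: pathin_def continuous_map_def)

lemma epath_pts: "pre_mdspace X \<Longrightarrow> \<gamma> \<in> epaths X \<Longrightarrow> t \<in> {0..1} \<Longrightarrow> \<gamma> t \<in> pts X"
  by (auto simp: pre_mdspace_def intro: pathin_topspace)

lemma mdmaps_pts: "f \<in> mdmaps X Y \<Longrightarrow> x \<in> pts X \<Longrightarrow> f x \<in> pts Y"
  by (auto simp: mdmaps_def continuous_map_def)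

lemma mdmaps_states: "f \<in> mdmaps X Y \<Longrightarrow> x \<in> states X \<Longrightarrow> f x \<in> states Y"
  by (auto simp: mdmaps_def)

lemma mdmaps_epaths: "f \<in> mdmaps X Y \<Longrightarrow> \<gamma> \<in> epaths X \<Longrightarrow> compose {0..1} f \<gamma> \<in> epaths Y"
  by (auto simp: mdmaps_def)

lemma mdmaps_continuous: "f \<in> mdmaps X Y \<Longrightarrow> continuous_map (under X) (under Y) f"
  by (auto simp: mdmaps_def)

lemma mdmaps_compose:
  assumes X: "pre_mdspace X" and f: "f \<in> mdmaps X Y" and g: "g \<in> mdmaps Y Z"
  shows "compose (pts X) g f \<in> mdmaps X Z"
proof -
  have "continuous_map (under X) (under Z) (compose (pts X) g f)"
    by (rule continuous_map_eq[OF continuous_map_compose[OF mdmaps_continuous[OF f] mdmaps_continuous[OF g]]])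
      (simp add: compose_def)
  moreover have "compose {0..1} (compose (pts X) g f) \<gamma> = compose {0..1} g (compose {0..1} f \<gamma>)"
    if "\<gamma> \<in> epaths X" for \<gamma>
    using epath_pts[OF X that] by (auto simp: compose_def)
  moreover have "compose (pts X) g f ` states X \<subseteq> states Z"
    using mdmaps_states[OF f] mdmaps_states[OF g] X by (auto simp: compose_def pre_mdspace_def)
  ultimately show ?thesis
    using mdmaps_epaths[OF g mdmaps_epaths[OF f]] by (simp add: mdmaps_def)
qed

lemma restrict_id_mdmaps:
  assumes "pre_mdspace X" "under Y = under X" "states X \<subseteq> states Y" "epaths X \<subseteq> epaths Y"
  shows "(\<lambda>x\<in>pts X. x) \<in> mdmaps X Y"
proof -
  have "compose {0..1} (\<lambda>x\<in>pts X. x) \<gamma> = \<gamma>" if "\<gamma> \<in> epaths X" for \<gamma>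
    using epath_pts[OF assms(1) that] that assms(1)
    by (auto simp: compose_def fun_eq_iff pre_mdspace_def extensional_def)
  moreover have "continuous_map (under X) (under Y) (\<lambda>x\<in>pts X. x)"
    unfolding assms(2) by (rule continuous_map_eq[OF continuous_map_id]) simp
  ultimately show ?thesis
    using assms by (auto simp: mdmaps_def pre_mdspace_def)
qed

lemma compose_eq_iff:
  "u \<in> extensional A \<Longrightarrow> compose A w i = u \<longleftrightarrow> (\<forall>a\<in>A. w (i a) = u a)"
  by (auto simp: compose_def fun_eq_iff extensional_def)

lemma compose_eq_compose_iff:
  "compose A u f = compose A v g \<longleftrightarrow> (\<forall>a\<in>A. u (f a) = v (g a))"
  by (auto simp: compose_def fun_eq_iff)

text \<open>
  An isomorphic copy of \<open>X\<close> in another type (for \<open>\<iota>\<close> injective on the points), where it can serve as a test object.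
\<close>

definition image_mdspace :: "('a \<Rightarrow> 'b) \<Rightarrow> 'a mdspace \<Rightarrow> 'b mdspace"
  where "image_mdspace \<iota> X =
    \<lparr>under = pullback_topology (\<iota> ` pts X) (inv_into (pts X) \<iota>) (under X),
     states = \<iota> ` states X, epaths = compose {0..1} \<iota> ` epaths X\<rparr>"

lemma image_mdspace_homeomorphic:
  assumes inj: "inj_on \<iota> (pts X)"
  shows "homeomorphic_maps (under X) (under (image_mdspace \<iota> X)) \<iota> (inv_into (pts X) \<iota>)"
proof -
  let ?\<rho> = "inv_into (pts X) \<iota>"
  let ?I = "under (image_mdspace \<iota> X)"
  have "continuous_map (under X) (under X) (?\<rho> \<circ> \<iota>)"
    by (rule continuous_map_eq[OF continuous_map_id]) (simp add: inj)
  then have "continuous_map (under X) ?I \<iota>"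
    unfolding image_mdspace_def by (auto intro: continuous_map_pullback')
  moreover have "continuous_map ?I (under X) (id \<circ> ?\<rho>)"
    unfolding image_mdspace_def mdspace.simps
    by (rule continuous_map_pullback[OF continuous_map_id])
  moreover have "topspace ?I \<subseteq> \<iota> ` pts X"
    by (auto simp: image_mdspace_def topspace_pullback_topology)
  ultimately show ?thesis
    using inj by (auto simp: homeomorphic_maps_def f_inv_into_f)
qed

lemma pts_image_mdspace:
  "inj_on \<iota> (pts X) \<Longrightarrow> pts (image_mdspace \<iota> X) = \<iota> ` pts X"
  by (auto simp: image_mdspace_def topspace_pullback_topology)

lemma is_mdspace_image:
  assumes X: "is_mdspace T (reparam s) X" and inj: "inj_on \<iota> (pts X)"
  shows "is_mdspace T (reparam s) (image_mdspace \<iota> X)"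
proof -
  note hom = image_mdspace_homeomorphic[OF inj]
  let ?I = "image_mdspace \<iota> X"
  note pre = is_mdspace_pre[OF X]
  have cont: "continuous_map (under X) (under ?I) \<iota>" using hom by (simp add: homeomorphic_maps_def)
  have ep: "epaths ?I = compose {0..1} \<iota> ` epaths X" and st: "states ?I = \<iota> ` states X"
    by (simp_all add: image_mdspace_def)
  have "in_top T (under ?I)"
    using homeomorphic_maps_in_top[OF hom] X by (simp add: is_mdspace_def)
  moreover have "states ?I \<subseteq> pts ?I"
    using X unfolding pts_image_mdspace[OF inj] st by (auto simp: is_mdspace_def)
  moreover have "compose {0..1} \<iota> \<gamma> \<in> extensional {0..1} \<and> pathin (under ?I) (compose {0..1} \<iota> \<gamma>) \<and>
    compose {0..1} \<iota> \<gamma> 0 \<in> states ?I \<and> compose {0..1} \<iota> \<gamma> 1 \<in> states ?I"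
    if "\<gamma> \<in> epaths X" for \<gamma>
  proof -
    have \<gamma>: "pathin (under X) \<gamma>" "\<gamma> 0 \<in> states X" "\<gamma> 1 \<in> states X"
      using X that by (auto simp: is_mdspace_def)
    have "pathin (under ?I) (compose {0..1} \<iota> \<gamma>)"
      unfolding pathin_def
      by (rule continuous_map_eq[OF continuous_map_compose[OF \<gamma>(1)[unfolded pathin_def] cont]])
        (simp add: compose_def)
    then show ?thesis using \<gamma> unfolding st by (simp add: compose_def)
  qed
  moreover have "compose {0..1} (compose {0..1} \<iota> \<gamma>) \<phi> \<in> epaths ?I"
    if "\<gamma> \<in> epaths X" "\<phi> \<in> reparam s 1 1" for \<gamma> \<phi>
  proof -
    have "compose {0..1} (compose {0..1} \<iota> \<gamma>) \<phi> = compose {0..1} \<iota> (compose {0..1} \<gamma> \<phi>)"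
      using reparam_range[OF that(2)] by (auto simp: compose_def)
    moreover have "compose {0..1} \<gamma> \<phi> \<in> epaths X" using X that by (auto simp: is_mdspace_def)
    ultimately show ?thesis unfolding ep by (metis imageI)
  qed
  moreover have "norm_comp (compose {0..1} \<iota> \<gamma>1) (compose {0..1} \<iota> \<gamma>2) \<in> epaths ?I"
    if "\<gamma>1 \<in> epaths X" "\<gamma>2 \<in> epaths X" "compose {0..1} \<iota> \<gamma>1 1 = compose {0..1} \<iota> \<gamma>2 0" for \<gamma>1 \<gamma>2
  proof -
    have "\<gamma>1 1 \<in> pts X" "\<gamma>2 0 \<in> pts X" using epath_pts[OF pre] that by auto
    then have "\<gamma>1 1 = \<gamma>2 0" using that(3) inj by (auto simp: compose_def inj_on_def)
    then have "norm_comp \<gamma>1 \<gamma>2 \<in> epaths X" using X that by (auto simp: is_mdspace_def)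
    moreover have "norm_comp (compose {0..1} \<iota> \<gamma>1) (compose {0..1} \<iota> \<gamma>2) = compose {0..1} \<iota> (norm_comp \<gamma>1 \<gamma>2)"
      by (auto simp: norm_comp_def compose_def fun_eq_iff)
    ultimately show ?thesis unfolding ep by simp
  qed
  ultimately show ?thesis unfolding is_mdspace_def ep by blast
qed

lemma image_mdspace_mdmaps:
  assumes X: "pre_mdspace X" and inj: "inj_on \<iota> (pts X)"
  shows "restrict \<iota> (pts X) \<in> mdmaps X (image_mdspace \<iota> X)"
    and "restrict (inv_into (pts X) \<iota>) (\<iota> ` pts X) \<in> mdmaps (image_mdspace \<iota> X) X"
proof -
  let ?\<rho> = "inv_into (pts X) \<iota>" and ?I = "image_mdspace \<iota> X"
  note hom = image_mdspace_homeomorphic[OF inj]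
  have pts: "pts ?I = \<iota> ` pts X" by (rule pts_image_mdspace[OF inj])
  have "continuous_map (under X) (under ?I) (restrict \<iota> (pts X))"
    using hom by (auto simp: homeomorphic_maps_def elim: continuous_map_eq)
  moreover have "compose {0..1} (restrict \<iota> (pts X)) \<gamma> = compose {0..1} \<iota> \<gamma>" if "\<gamma> \<in> epaths X" for \<gamma>
    using epath_pts[OF X that] by (auto simp: compose_def)
  ultimately show "restrict \<iota> (pts X) \<in> mdmaps X ?I"
    using X by (auto simp: mdmaps_def image_mdspace_def pre_mdspace_def)
  have "continuous_map (under ?I) (under X) (restrict ?\<rho> (\<iota> ` pts X))"
    using hom pts by (auto simp: homeomorphic_maps_def elim: continuous_map_eq)
  moreover have "compose {0..1} (restrict ?\<rho> (\<iota> ` pts X)) (compose {0..1} \<iota> \<gamma>) = \<gamma>"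
    if "\<gamma> \<in> epaths X" for \<gamma>
    using epath_pts[OF X that] inj X that
    by (auto simp: compose_def fun_eq_iff pre_mdspace_def extensional_def)
  moreover have "restrict ?\<rho> (\<iota> ` pts X) (\<iota> x) \<in> states X" if "x \<in> states X" for x
    using that X inj by (auto simp: pre_mdspace_def subset_eq)
  moreover have "states ?I = \<iota> ` states X" "epaths ?I = compose {0..1} \<iota> ` epaths X"
    by (simp_all add: image_mdspace_def)
  ultimately show "restrict ?\<rho> (\<iota> ` pts X) \<in> mdmaps ?I X"
    unfolding mdmaps_def pts by (simp add: image_subset_iff)
qed

section \<open>Universal properties for arbitrary test objects\<close>

text \<open>
  The definition of a pushout quantifies over test objects of one fixed type. Any test object that
  injects into that type may be used as well: replace it by its image, and compare maps through the
  isomorphism. The same argument gives the corresponding statement for colimits.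
\<close>

lemma pushout_universal:
  fixes E :: "'e mdspace" and \<iota> :: "'e \<Rightarrow> 'b + 'a"
    and B :: "'b mdspace" and C :: "'a mdspace"
  assumes po: "is_pushout T (reparam s) A B C D f g i j"
    and pre: "pre_mdspace B" "pre_mdspace C" "pre_mdspace D"
    and E: "is_mdspace T (reparam s) E" and inj: "inj_on \<iota> (pts E)"
  shows "\<lbrakk>u \<in> mdmaps B E; v \<in> mdmaps C E; \<forall>a\<in>pts A. u (f a) = v (g a)\<rbrakk> \<Longrightarrow>
      \<exists>w\<in>mdmaps D E. (\<forall>b\<in>pts B. w (i b) = u b) \<and> (\<forall>c\<in>pts C. w (j c) = v c)"
    and "\<lbrakk>w1 \<in> mdmaps D E; w2 \<in> mdmaps D E; \<forall>b\<in>pts B. w1 (i b) = w2 (i b);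
      \<forall>c\<in>pts C. w1 (j c) = w2 (j c)\<rbrakk> \<Longrightarrow> w1 = w2"
proof -
  define \<iota>' where "\<iota>' = restrict \<iota> (pts E)"
  define \<rho> where "\<rho> = restrict (inv_into (pts E) \<iota>) (\<iota> ` pts E)"
  define I where "I = image_mdspace \<iota> E"
  note maps = image_mdspace_mdmaps[OF is_mdspace_pre[OF E] inj, folded \<iota>'_def \<rho>_def I_def]
  have I: "is_mdspace T (reparam s) I" unfolding I_def by (rule is_mdspace_image[OF E inj])
  have \<rho>\<iota>: "\<rho> (\<iota>' x) = x" if "x \<in> pts E" for x using that inj by (simp add: \<rho>_def \<iota>'_def)
  have f: "f \<in> mdmaps A B" and g: "g \<in> mdmaps A C" and i: "i \<in> mdmaps B D" and j: "j \<in> mdmaps C D"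
    and comm: "\<forall>a\<in>pts A. i (f a) = j (g a)"
    using po by (auto simp: is_pushout_def compose_eq_compose_iff)
  have ex1: "\<exists>!w. w \<in> mdmaps D I \<and> (\<forall>b\<in>pts B. w (i b) = u b) \<and> (\<forall>c\<in>pts C. w (j c) = v c)"
    if "u \<in> mdmaps B I" "v \<in> mdmaps C I" "\<forall>a\<in>pts A. u (f a) = v (g a)" for u v
  proof -
    have "u \<in> extensional (pts B)" "v \<in> extensional (pts C)" using that by (auto simp: mdmaps_def)
    note eqs = this[THEN compose_eq_iff]
    have "\<exists>!w. w \<in> mdmaps D I \<and> compose (pts B) w i = u \<and> compose (pts C) w j = v"
      using po that I unfolding is_pushout_def compose_eq_compose_iff by blast
    then show ?thesis unfolding eqs .
  qed
  show "\<exists>w\<in>mdmaps D E. (\<forall>b\<in>pts B. w (i b) = u b) \<and> (\<forall>c\<in>pts C. w (j c) = v c)"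
    if u: "u \<in> mdmaps B E" and v: "v \<in> mdmaps C E" and uv: "\<forall>a\<in>pts A. u (f a) = v (g a)"
  proof -
    have "compose (pts B) \<iota>' u \<in> mdmaps B I" "compose (pts C) \<iota>' v \<in> mdmaps C I"
      using mdmaps_compose maps pre u v by blast+
    moreover have "\<forall>a\<in>pts A. compose (pts B) \<iota>' u (f a) = compose (pts C) \<iota>' v (g a)"
      using uv mdmaps_pts[OF f] mdmaps_pts[OF g] by (simp add: compose_def)
    ultimately obtain w where w: "w \<in> mdmaps D I"
      "\<forall>b\<in>pts B. w (i b) = compose (pts B) \<iota>' u b" "\<forall>c\<in>pts C. w (j c) = compose (pts C) \<iota>' v c"
      using ex1 by blast
    have "compose (pts D) \<rho> w \<in> mdmaps D E" using mdmaps_compose[OF pre(3) w(1) maps(2)] .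
    moreover have "compose (pts D) \<rho> w (i b) = u b" if "b \<in> pts B" for b
      using w(2) that mdmaps_pts[OF i that] mdmaps_pts[OF u that] \<rho>\<iota> by (simp add: compose_def)
    moreover have "compose (pts D) \<rho> w (j c) = v c" if "c \<in> pts C" for c
      using w(3) that mdmaps_pts[OF j that] mdmaps_pts[OF v that] \<rho>\<iota> by (simp add: compose_def)
    ultimately show ?thesis by blast
  qed
  show "w1 = w2"
    if w: "w1 \<in> mdmaps D E" "w2 \<in> mdmaps D E" and B: "\<forall>b\<in>pts B. w1 (i b) = w2 (i b)"
      and C: "\<forall>c\<in>pts C. w1 (j c) = w2 (j c)"
  proof -
    let ?w1 = "compose (pts D) \<iota>' w1" and ?w2 = "compose (pts D) \<iota>' w2"
    have w': "?w1 \<in> mdmaps D I" "?w2 \<in> mdmaps D I" using mdmaps_compose maps pre w by blast+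
    let ?u = "compose (pts B) ?w1 i" and ?v = "compose (pts C) ?w1 j"
    have uv: "?u \<in> mdmaps B I" "?v \<in> mdmaps C I" using mdmaps_compose pre i j w' by blast+
    moreover have "\<forall>a\<in>pts A. ?u (f a) = ?v (g a)"
      using comm mdmaps_pts[OF f] mdmaps_pts[OF g] by (simp add: compose_def)
    moreover have "\<forall>b\<in>pts B. ?w1 (i b) = ?u b" "\<forall>c\<in>pts C. ?w1 (j c) = ?v c" by (simp_all add: compose_def)
    moreover have "\<forall>b\<in>pts B. ?w2 (i b) = ?u b" "\<forall>c\<in>pts C. ?w2 (j c) = ?v c"
      using B C mdmaps_pts[OF i] mdmaps_pts[OF j] by (simp_all add: compose_def)
    ultimately have eq: "?w1 = ?w2" using ex1[of ?u ?v] w' by blast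
    show "w1 = w2"
    proof
      fix d
      show "w1 d = w2 d"
      proof (cases "d \<in> pts D")
        case True
        then have "\<iota>' (w1 d) = \<iota>' (w2 d)" using fun_cong[OF eq, of d] by (simp add: compose_def)
        then show ?thesis using True \<rho>\<iota> mdmaps_pts w by metis
      next
        case False
        then show ?thesis using w by (auto simp: mdmaps_def extensional_def)
      qed
    qed
  qed
qed

lemma chain_colimit_universal:
  fixes E :: "'e mdspace" and \<iota> :: "'e \<Rightarrow> 'i::wellorder \<times> 'a" and X :: "'i \<Rightarrow> 'a mdspace"
  assumes co: "is_chain_colimit T (reparam s) X tr \<nu>"
    and pre: "\<And>\<mu>. \<mu> \<le> \<nu> \<Longrightarrow> pre_mdspace (X \<mu>)"
    and tr: "\<And>\<mu> \<kappa>. \<mu> \<le> \<kappa> \<Longrightarrow> \<kappa> \<le> \<nu> \<Longrightarrow> tr \<mu> \<kappa> \<in> mdmaps (X \<mu>) (X \<kappa>)"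
    and E: "is_mdspace T (reparam s) E" and inj: "inj_on \<iota> (pts E)"
  shows "\<lbrakk>\<And>\<mu>. \<mu> < \<nu> \<Longrightarrow> u \<mu> \<in> mdmaps (X \<mu>) E;
      \<And>\<mu> \<kappa> x. \<mu> \<le> \<kappa> \<Longrightarrow> \<kappa> < \<nu> \<Longrightarrow> x \<in> pts (X \<mu>) \<Longrightarrow> u \<kappa> (tr \<mu> \<kappa> x) = u \<mu> x\<rbrakk> \<Longrightarrow>
      \<exists>w\<in>mdmaps (X \<nu>) E. \<forall>\<mu><\<nu>. \<forall>x\<in>pts (X \<mu>). w (tr \<mu> \<nu> x) = u \<mu> x"
    and "\<lbrakk>w1 \<in> mdmaps (X \<nu>) E; w2 \<in> mdmaps (X \<nu>) E;
      \<And>\<mu> x. \<mu> < \<nu> \<Longrightarrow> x \<in> pts (X \<mu>) \<Longrightarrow> w1 (tr \<mu> \<nu> x) = w2 (tr \<mu> \<nu> x)\<rbrakk> \<Longrightarrow> w1 = w2"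
proof -
  define \<iota>' where "\<iota>' = restrict \<iota> (pts E)"
  define \<rho> where "\<rho> = restrict (inv_into (pts E) \<iota>) (\<iota> ` pts E)"
  define I where "I = image_mdspace \<iota> E"
  note maps = image_mdspace_mdmaps[OF is_mdspace_pre[OF E] inj, folded \<iota>'_def \<rho>_def I_def]
  have I: "is_mdspace T (reparam s) I" unfolding I_def by (rule is_mdspace_image[OF E inj])
  have \<rho>\<iota>: "\<rho> (\<iota>' x) = x" if "x \<in> pts E" for x using that inj by (simp add: \<rho>_def \<iota>'_def)
  have comm: "tr \<kappa> \<nu> (tr \<mu> \<kappa> x) = tr \<mu> \<nu> x" if "\<mu> \<le> \<kappa>" "\<kappa> < \<nu>" "x \<in> pts (X \<mu>)" for \<mu> \<kappa> x
    using co that unfolding is_chain_colimit_def by (metis compose_eq)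
  have ex1: "\<exists>!w. w \<in> mdmaps (X \<nu>) I \<and> (\<forall>\<mu><\<nu>. \<forall>x\<in>pts (X \<mu>). w (tr \<mu> \<nu> x) = u \<mu> x)"
    if u: "\<And>\<mu>. \<mu> < \<nu> \<Longrightarrow> u \<mu> \<in> mdmaps (X \<mu>) I"
      "\<And>\<mu> \<kappa> x. \<mu> \<le> \<kappa> \<Longrightarrow> \<kappa> < \<nu> \<Longrightarrow> x \<in> pts (X \<mu>) \<Longrightarrow> u \<kappa> (tr \<mu> \<kappa> x) = u \<mu> x" for u
  proof -
    have ext: "u \<mu> \<in> extensional (pts (X \<mu>))" if "\<mu> < \<nu>" for \<mu> using u(1)[OF that] by (auto simp: mdmaps_def)
    have "\<forall>\<mu> \<kappa>. \<mu> \<le> \<kappa> \<and> \<kappa> < \<nu> \<longrightarrow> compose (pts (X \<mu>)) (u \<kappa>) (tr \<mu> \<kappa>) = u \<mu>"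
      using u(2) compose_eq_iff[OF ext] by (meson order.strict_trans1)
    then have "\<exists>!w. w \<in> mdmaps (X \<nu>) I \<and> (\<forall>\<mu><\<nu>. compose (pts (X \<mu>)) w (tr \<mu> \<nu>) = u \<mu>)"
      using co[unfolded is_chain_colimit_def, THEN conjunct2, THEN conjunct2, THEN spec[of _ I],
          THEN spec[of _ u], THEN mp] I u(1) by simp
    then show ?thesis by (simp add: compose_eq_iff[OF ext] cong: conj_cong)
  qed
  show "\<exists>w\<in>mdmaps (X \<nu>) E. \<forall>\<mu><\<nu>. \<forall>x\<in>pts (X \<mu>). w (tr \<mu> \<nu> x) = u \<mu> x"
    if u: "\<And>\<mu>. \<mu> < \<nu> \<Longrightarrow> u \<mu> \<in> mdmaps (X \<mu>) E"
      "\<And>\<mu> \<kappa> x. \<mu> \<le> \<kappa> \<Longrightarrow> \<kappa> < \<nu> \<Longrightarrow> x \<in> pts (X \<mu>) \<Longrightarrow> u \<kappa> (tr \<mu> \<kappa> x) = u \<mu> x"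
  proof -
    define u' where "u' \<mu> = compose (pts (X \<mu>)) \<iota>' (u \<mu>)" for \<mu>
    have "u' \<mu> \<in> mdmaps (X \<mu>) I" if "\<mu> < \<nu>" for \<mu>
      using mdmaps_compose[OF pre u(1) maps(1)] that by (simp add: u'_def)
    moreover have "u' \<kappa> (tr \<mu> \<kappa> x) = u' \<mu> x" if "\<mu> \<le> \<kappa>" "\<kappa> < \<nu>" "x \<in> pts (X \<mu>)" for \<mu> \<kappa> x
      using u(2)[OF that] mdmaps_pts[OF tr[of \<mu> \<kappa>]] that by (simp add: u'_def compose_def)
    ultimately obtain w where w: "w \<in> mdmaps (X \<nu>) I" "\<forall>\<mu><\<nu>. \<forall>x\<in>pts (X \<mu>). w (tr \<mu> \<nu> x) = u' \<mu> x"
      using ex1[of u'] by blast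
    have "compose (pts (X \<nu>)) \<rho> w \<in> mdmaps (X \<nu>) E" using mdmaps_compose[OF pre w(1) maps(2)] by simp
    moreover have "compose (pts (X \<nu>)) \<rho> w (tr \<mu> \<nu> x) = u \<mu> x" if "\<mu> < \<nu>" "x \<in> pts (X \<mu>)" for \<mu> x
      using w(2) that mdmaps_pts[OF tr[of \<mu> \<nu>]] mdmaps_pts[OF u(1)] \<rho>\<iota> by (simp add: compose_def u'_def)
    ultimately show ?thesis by blast
  qed
  show "w1 = w2"
    if w: "w1 \<in> mdmaps (X \<nu>) E" "w2 \<in> mdmaps (X \<nu>) E"
      and agree: "\<And>\<mu> x. \<mu> < \<nu> \<Longrightarrow> x \<in> pts (X \<mu>) \<Longrightarrow> w1 (tr \<mu> \<nu> x) = w2 (tr \<mu> \<nu> x)"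
  proof -
    let ?w1 = "compose (pts (X \<nu>)) \<iota>' w1" and ?w2 = "compose (pts (X \<nu>)) \<iota>' w2"
    have w': "?w1 \<in> mdmaps (X \<nu>) I" "?w2 \<in> mdmaps (X \<nu>) I" using mdmaps_compose maps pre w by blast+
    define u where "u \<mu> = compose (pts (X \<mu>)) ?w1 (tr \<mu> \<nu>)" for \<mu>
    have "u \<mu> \<in> mdmaps (X \<mu>) I" if "\<mu> < \<nu>" for \<mu>
      using mdmaps_compose[OF pre tr w'(1)] that by (simp add: u_def)
    moreover have "u \<kappa> (tr \<mu> \<kappa> x) = u \<mu> x" if "\<mu> \<le> \<kappa>" "\<kappa> < \<nu>" "x \<in> pts (X \<mu>)" for \<mu> \<kappa> x
      using comm[OF that] mdmaps_pts[OF tr[of \<mu> \<kappa>]] that by (simp add: u_def compose_def)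
    ultimately have uniq: "\<exists>!w. w \<in> mdmaps (X \<nu>) I \<and> (\<forall>\<mu><\<nu>. \<forall>x\<in>pts (X \<mu>). w (tr \<mu> \<nu> x) = u \<mu> x)"
      by (rule ex1)
    have "?w1 (tr \<mu> \<nu> x) = u \<mu> x" "?w2 (tr \<mu> \<nu> x) = u \<mu> x"
      if "\<mu> < \<nu>" "x \<in> pts (X \<mu>)" for \<mu> x
      using agree that mdmaps_pts[OF tr[of \<mu> \<nu>]] by (simp_all add: u_def compose_def)
    note leg = this
    from uniq obtain w0 where w0: "\<And>w. w \<in> mdmaps (X \<nu>) I \<Longrightarrow>
        (\<forall>\<mu><\<nu>. \<forall>x\<in>pts (X \<mu>). w (tr \<mu> \<nu> x) = u \<mu> x) \<Longrightarrow> w = w0"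
      by (elim ex1E) blast
    have "?w1 = w0" "?w2 = w0" by (rule w0; use w' leg in blast)+
    then have eq: "?w1 = ?w2" by simp
    show "w1 = w2"
    proof
      fix d
      show "w1 d = w2 d"
      proof (cases "d \<in> pts (X \<nu>)")
        case True
        then have "\<iota>' (w1 d) = \<iota>' (w2 d)" using fun_cong[OF eq, of d] by (simp add: compose_def)
        then show ?thesis using True \<rho>\<iota> mdmaps_pts w by metis
      next
        case False
        then show ?thesis using w by (auto simp: mdmaps_def extensional_def)
      qed
    qed
  qed
qed

lemma restrict_id_epaths:
  assumes w: "(\<lambda>x\<in>pts D. x) \<in> mdmaps D E" and D: "pre_mdspace D"
  shows "states D \<subseteq> states E" "epaths D \<subseteq> epaths E"
proof -
  show "states D \<subseteq> states E"
    using mdmaps_states[OF w] D by (force simp: pre_mdspace_def)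
  have "compose {0..1} (\<lambda>x\<in>pts D. x) \<gamma> = \<gamma>" if "\<gamma> \<in> epaths D" for \<gamma>
    using epath_pts[OF D that] that D
    by (auto simp: compose_def fun_eq_iff pre_mdspace_def extensional_def)
  then show "epaths D \<subseteq> epaths E" using mdmaps_epaths[OF w] by fastforce
qed

text \<open>
  A pushout is generated by its two legs: if both legs land in a sub-object \<open>E\<close> with the same
  underlying space, they induce a map to \<open>E\<close>; followed by the inclusion, it must be the identity
  by uniqueness.
\<close>

lemma pushout_generated:
  assumes po: "is_pushout T (reparam s) A B C D f g i j"
    and pre: "pre_mdspace B" "pre_mdspace C" and D: "is_mdspace T (reparam s) D"
    and E: "is_mdspace T (reparam s) E" "under E = under D" "states E \<subseteq> states D" "epaths E \<subseteq> epaths D"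
    and i: "i \<in> mdmaps B E" and j: "j \<in> mdmaps C E"
  shows "states D \<subseteq> states E" "epaths D \<subseteq> epaths E"
proof -
  note D' = is_mdspace_pre[OF D]
  have "\<forall>a\<in>pts A. i (f a) = j (g a)" using po by (auto simp: is_pushout_def compose_eq_compose_iff)
  then obtain w where w: "w \<in> mdmaps D E" "\<forall>b\<in>pts B. w (i b) = i b" "\<forall>c\<in>pts C. w (j c) = j c"
    using pushout_universal(1)[OF po pre D' E(1) inj_on_subset[OF inj_Inr subset_UNIV] i j] by blast
  have "w \<in> mdmaps D D" using w(1) E by (auto simp: mdmaps_def)
  moreover have "(\<lambda>x\<in>pts D. x) \<in> mdmaps D D" by (rule restrict_id_mdmaps[OF D']) auto
  ultimately have "w = (\<lambda>x\<in>pts D. x)"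
    using w(2,3) mdmaps_pts[OF i] mdmaps_pts[OF j] E(2)
    by (intro pushout_universal(2)[OF po pre D' D inj_on_subset[OF inj_Inr subset_UNIV]]) auto
  then show "states D \<subseteq> states E" "epaths D \<subseteq> epaths E"
    using restrict_id_epaths[OF _ D'] w(1) by blast+
qed

lemma chain_colimit_generated:
  fixes X :: "'i::wellorder \<Rightarrow> 'a mdspace"
  assumes co: "is_chain_colimit T (reparam s) X tr \<nu>"
    and X: "\<And>\<mu>. \<mu> \<le> \<nu> \<Longrightarrow> is_mdspace T (reparam s) (X \<mu>)"
    and tr: "\<And>\<mu> \<kappa>. \<mu> \<le> \<kappa> \<Longrightarrow> \<kappa> \<le> \<nu> \<Longrightarrow> tr \<mu> \<kappa> \<in> mdmaps (X \<mu>) (X \<kappa>)"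
    and E: "is_mdspace T (reparam s) E" "under E = under (X \<nu>)" "states E \<subseteq> states (X \<nu>)"
      "epaths E \<subseteq> epaths (X \<nu>)"
    and j: "\<And>\<mu>. \<mu> < \<nu> \<Longrightarrow> tr \<mu> \<nu> \<in> mdmaps (X \<mu>) E"
  shows "states (X \<nu>) \<subseteq> states E" "epaths (X \<nu>) \<subseteq> epaths E"
proof -
  have pre: "pre_mdspace (X \<mu>)" if "\<mu> \<le> \<nu>" for \<mu> using is_mdspace_pre[OF X[OF that]] .
  note D' = pre[OF order_refl]
  have inj: "inj_on (Pair (undefined :: 'i)) A" for A :: "'a set" by (simp add: inj_on_def)
  have comm: "tr \<kappa> \<nu> (tr \<mu> \<kappa> x) = tr \<mu> \<nu> x" if "\<mu> \<le> \<kappa>" "\<kappa> < \<nu>" "x \<in> pts (X \<mu>)" for \<mu> \<kappa> x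
    using co that unfolding is_chain_colimit_def by (metis compose_eq)
  obtain w where w: "w \<in> mdmaps (X \<nu>) E" "\<forall>\<mu><\<nu>. \<forall>x\<in>pts (X \<mu>). w (tr \<mu> \<nu> x) = tr \<mu> \<nu> x"
    using chain_colimit_universal(1)[OF co pre tr E(1) inj, of "\<lambda>\<mu>. tr \<mu> \<nu>"] j comm by blast
  have "w \<in> mdmaps (X \<nu>) (X \<nu>)" using w(1) E by (auto simp: mdmaps_def)
  moreover have "(\<lambda>x\<in>pts (X \<nu>). x) \<in> mdmaps (X \<nu>) (X \<nu>)" by (rule restrict_id_mdmaps[OF D']) auto
  ultimately have "w = (\<lambda>x\<in>pts (X \<nu>). x)"
    using w(2) mdmaps_pts[OF j] E(2)
    by (intro chain_colimit_universal(2)[OF co pre tr X[OF order_refl] inj]) auto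
  then show "states (X \<nu>) \<subseteq> states E" "epaths (X \<nu>) \<subseteq> epaths E"
    using restrict_id_epaths[OF _ D'] w(1) by blast+
qed

section \<open>Globes\<close>

lemma pts_Glob [simp]: "pts (Glob P Z) = glob_set Z"
  by (simp add: Glob_def topspace_glob_top)

lemma glob_pt_simps [simp]: "glob_pt z 0 = GSrc" "glob_pt z 1 = GTgt"
  by (simp_all add: glob_pt_def)

lemma glob_set_simps [simp]: "GSrc \<in> glob_set Z" "GTgt \<in> glob_set Z"
  by (simp_all add: glob_set_def)

lemma glob_pt_glob_set: "z \<in> topspace Z \<Longrightarrow> t \<in> {0..1} \<Longrightarrow> glob_pt z t \<in> glob_set Z"
  by (auto simp: glob_set_def)

lemma continuous_map_glob_pt:
  "continuous_map (prod_topology Z unit_interval) (glob_top Z) (\<lambda>(z, t). glob_pt z t)"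
  unfolding continuous_map_def
proof (intro conjI allI impI)
  show "(\<lambda>(z, t). glob_pt z t) \<in> topspace (prod_topology Z unit_interval) \<rightarrow> topspace (glob_top Z)"
    by (auto simp: topspace_glob_top intro: glob_pt_glob_set)
  fix U assume "openin (glob_top Z) U"
  then have "openin (prod_topology Z unit_interval)
      {(z, t). z \<in> topspace Z \<and> t \<in> {0..1} \<and> glob_pt z t \<in> U}"
    by (simp add: openin_glob_top)
  moreover have "{x \<in> topspace (prod_topology Z unit_interval). (case x of (z, t) \<Rightarrow> glob_pt z t) \<in> U} =
      {(z, t). z \<in> topspace Z \<and> t \<in> {0..1} \<and> glob_pt z t \<in> U}"
    by auto
  ultimately show "openin (prod_topology Z unit_interval)
      {x \<in> topspace (prod_topology Z unit_interval). (case x of (z, t) \<Rightarrow> glob_pt z t) \<in> U}"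
    by simp
qed

lemma compose_delta:
  assumes "\<phi> \<in> reparam s 1 1"
  shows "compose {0..1} (delta z) \<phi> = (\<lambda>t\<in>{0..1}. glob_pt z (\<phi> t))"
  using reparam_range[OF assms] by (auto simp: compose_def delta_def)

lemma pre_mdspace_Glob: "pre_mdspace (Glob (reparam s) Z)"
proof -
  have "pathin (glob_top Z) (\<lambda>t\<in>{0..1}. glob_pt z (\<phi> t))" if "z \<in> topspace Z" "\<phi> \<in> reparam s 1 1" for z \<phi>
  proof -
    have "continuous_map unit_interval unit_interval \<phi>"
      using reparam_continuous[OF that(2)] reparam_range[OF that(2)] by auto
    then have "continuous_map unit_interval (prod_topology Z unit_interval) (\<lambda>t. (z, \<phi> t))"
      using that by (simp add: continuous_map_pairwise o_def)
    from continuous_map_compose[OF this continuous_map_glob_pt] show ?thesis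
      unfolding pathin_def by (rule continuous_map_eq) simp
  qed
  then show ?thesis
    by (auto simp: pre_mdspace_def Glob_def compose_delta topspace_glob_top)
qed

section \<open>Existence of decompositions\<close>

lemma osucc_greater: "\<nu> < \<mu> \<Longrightarrow> \<nu> < osucc \<nu>"
  unfolding osucc_def by (rule LeastI)

lemma osucc_le: "\<nu> < \<mu> \<Longrightarrow> osucc \<nu> \<le> \<mu>"
  unfolding osucc_def by (rule Least_le)

lemma ozero_le: "ozero \<le> \<mu>"
  unfolding ozero_def by (rule Least_le) simp

lemma ordinal_cases [case_names zero succ limit]:
  assumes "\<nu> = ozero \<Longrightarrow> thesis" and "\<And>\<mu>. \<mu> < \<nu> \<Longrightarrow> \<nu> = osucc \<mu> \<Longrightarrow> thesis" and "olimit \<nu> \<Longrightarrow> thesis"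
  shows thesis
  using assms unfolding olimit_def by blast

locale cellular_mdspace =
  fixes T :: top_cat and s :: bool and lam :: "'i::wellorder"
    and X :: "'i \<Rightarrow> 'a mdspace" and tr :: "'i \<Rightarrow> 'i \<Rightarrow> 'a \<Rightarrow> 'a" and dm :: "'i \<Rightarrow> nat"
    and g h :: "'i \<Rightarrow> (nat \<Rightarrow> real) globe \<Rightarrow> 'a"
  assumes cellular: "cellular T (reparam s) lam X tr dm g h"
begin

abbreviation gh :: "'i \<Rightarrow> (nat \<Rightarrow> real) globe \<Rightarrow> 'a"
  where "gh \<equiv> ghat (reparam s) lam tr dm h"

lemma mdspace: "\<nu> \<le> lam \<Longrightarrow> is_mdspace T (reparam s) (X \<nu>)"
  using cellular by (simp add: cellular_def)

lemma pre_mdspace: "\<nu> \<le> lam \<Longrightarrow> pre_mdspace (X \<nu>)"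
  by (rule is_mdspace_pre[OF mdspace])

lemma transition: "\<mu> \<le> \<nu> \<Longrightarrow> \<nu> \<le> lam \<Longrightarrow> tr \<mu> \<nu> \<in> mdmaps (X \<mu>) (X \<nu>)"
  using cellular by (simp add: cellular_def)

lemma transition_id: "\<nu> \<le> lam \<Longrightarrow> x \<in> pts (X \<nu>) \<Longrightarrow> tr \<nu> \<nu> x = x"
  using cellular by (simp add: cellular_def)

lemma transition_compose:
  assumes "\<mu> \<le> \<kappa>" "\<kappa> \<le> \<nu>" "\<nu> \<le> lam" "x \<in> pts (X \<mu>)"
  shows "tr \<kappa> \<nu> (tr \<mu> \<kappa> x) = tr \<mu> \<nu> x"
proof -
  have "compose (pts (X \<mu>)) (tr \<kappa> \<nu>) (tr \<mu> \<kappa>) = tr \<mu> \<nu>"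
    using cellular assms(1-3) unfolding cellular_def by blast
  then show ?thesis using assms(4) by (metis compose_eq)
qed

lemma pushout: "\<nu> < lam \<Longrightarrow> is_pushout T (reparam s) (Glob (reparam s) (bsphere (dm \<nu>)))
    (Glob (reparam s) (disk (dm \<nu>))) (X \<nu>) (X (osucc \<nu>)) (glob_incl (reparam s) (dm \<nu>)) (g \<nu>) (h \<nu>) (tr \<nu> (osucc \<nu>))"
  using cellular by (simp add: cellular_def)

lemma colimit: "\<nu> \<le> lam \<Longrightarrow> olimit \<nu> \<Longrightarrow> is_chain_colimit T (reparam s) X tr \<nu>"
  using cellular by (simp add: cellular_def)

lemma succ: assumes "\<nu> < lam" shows "\<nu> < osucc \<nu>" "\<nu> \<le> osucc \<nu>" "osucc \<nu> \<le> lam"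
  using osucc_greater[OF assms] osucc_le[OF assms] by auto

lemma attach_map: "\<nu> < lam \<Longrightarrow> g \<nu> \<in> mdmaps (Glob (reparam s) (bsphere (dm \<nu>))) (X \<nu>)"
  and cell_map: "\<nu> < lam \<Longrightarrow> h \<nu> \<in> mdmaps (Glob (reparam s) (disk (dm \<nu>))) (X (osucc \<nu>))"
  using pushout by (auto simp: is_pushout_def)

text \<open>
  The sphere may be empty, but its globe still has two end points; so this also identifies the ends of the
  cell with states of the previous stage.
\<close>

lemma cell_map_boundary:
  assumes "\<nu> < lam" "x \<in> glob_set (bsphere (dm \<nu>))"
  shows "h \<nu> x = tr \<nu> (osucc \<nu>) (g \<nu> x)"
  using pushout[OF assms(1)] assms(2)
  by (auto simp: is_pushout_def compose_eq_compose_iff glob_incl_def)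

lemma gh_eq: "x \<in> glob_set (disk (dm \<nu>)) \<Longrightarrow> gh \<nu> x = tr (osucc \<nu>) lam (h \<nu> x)"
  by (simp add: ghat_def compose_def)

definition decomposable :: "(real \<Rightarrow> 'a) \<Rightarrow> bool"
  where "decomposable \<gamma> \<longleftrightarrow> (\<exists>ws \<psi>. ws \<noteq> [] \<and> set ws \<subseteq> open_cells lam dm \<and>
    \<psi> \<in> reparam s 1 (length ws) \<and> traces gh ws 1 \<psi> \<gamma>)"

lemma decomposable_reparam:
  "decomposable \<gamma> \<Longrightarrow> \<phi> \<in> reparam s 1 1 \<Longrightarrow> decomposable (compose {0..1} \<gamma> \<phi>)"
  unfolding decomposable_def by (blast intro: reparam_compose traces_compose)

text \<open>
  Normalized composition is the Moore composition of the two paths run at double speed.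
\<close>

lemma decomposable_norm_comp:
  assumes "decomposable \<gamma>1" "decomposable \<gamma>2" and eq: "\<gamma>1 1 = \<gamma>2 0"
  shows "decomposable (norm_comp \<gamma>1 \<gamma>2)"
proof -
  obtain ws1 \<psi>1 ws2 \<psi>2
    where 1: "ws1 \<noteq> []" "set ws1 \<subseteq> open_cells lam dm" "\<psi>1 \<in> reparam s 1 (length ws1)" "traces gh ws1 1 \<psi>1 \<gamma>1"
      and 2: "ws2 \<noteq> []" "set ws2 \<subseteq> open_cells lam dm" "\<psi>2 \<in> reparam s 1 (length ws2)" "traces gh ws2 1 \<psi>2 \<gamma>2"
    using assms unfolding decomposable_def by blast
  let ?r = "rescale (1 / 2)"
  have r: "?r \<in> reparam s (1 / 2) 1" by (rule rescale_reparam) simp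
  let ?\<psi>1 = "compose {0..1/2} \<psi>1 ?r" and ?\<psi>2 = "compose {0..1/2} \<psi>2 ?r"
    and ?\<gamma>1 = "compose {0..1/2} \<gamma>1 ?r" and ?\<gamma>2 = "compose {0..1/2} \<gamma>2 ?r"
  have re: "?\<psi>1 \<in> reparam s (1/2) (length ws1)" "?\<psi>2 \<in> reparam s (1/2) (length ws2)"
    using reparam_compose[OF r] 1(3) 2(3) by blast+
  have tr: "traces gh ws1 (1/2) ?\<psi>1 ?\<gamma>1" "traces gh ws2 (1/2) ?\<psi>2 ?\<gamma>2"
    using traces_compose[OF _ r] 1(4) 2(4) by blast+
  have "?\<gamma>1 (1/2) = ?\<gamma>2 0" using eq by (simp add: compose_def rescale_def)
  from traces_append[OF tr re 1(1) 2(1) _ _ this] reparam_tensor2[OF re]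
  obtain \<psi> where \<psi>: "\<psi> \<in> reparam s 1 (length (ws1 @ ws2))"
    "traces gh (ws1 @ ws2) 1 \<psi> (\<lambda>t\<in>{0..1}. if t \<le> 1/2 then ?\<gamma>1 t else ?\<gamma>2 (t - 1/2))"
    by fastforce
  have "(\<lambda>t\<in>{0..1}. if t \<le> 1/2 then ?\<gamma>1 t else ?\<gamma>2 (t - 1/2)) = norm_comp \<gamma>1 \<gamma>2"
    by (auto simp: norm_comp_def compose_def rescale_def fun_eq_iff algebra_simps)
  then show ?thesis
    using \<psi> 1 2 unfolding decomposable_def by (intro exI[of _ "ws1 @ ws2"] exI[of _ \<psi>]) auto
qed

text \<open>
  The sub-object of \<open>X \<nu>\<close> that turns out to be everything. The condition on the end points is built in
  because the uniqueness argument needs that all states come from \<open>X ozero\<close>, and this is obtained by the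
  same induction.
\<close>

definition generated :: "'i \<Rightarrow> 'a mdspace"
  where "generated \<nu> = \<lparr>under = under (X \<nu>), states = tr ozero \<nu> ` states (X ozero),
    epaths = {\<gamma> \<in> epaths (X \<nu>). \<gamma> 0 \<in> tr ozero \<nu> ` states (X ozero) \<and>
      \<gamma> 1 \<in> tr ozero \<nu> ` states (X ozero) \<and> decomposable (compose {0..1} (tr \<nu> lam) \<gamma>)}\<rparr>"

lemma generated_sub:
  assumes "\<nu> \<le> lam"
  shows "under (generated \<nu>) = under (X \<nu>)" "states (generated \<nu>) \<subseteq> states (X \<nu>)"
    "epaths (generated \<nu>) \<subseteq> epaths (X \<nu>)"
  using mdmaps_states[OF transition[OF ozero_le assms]] by (auto simp: generated_def)

lemma is_mdspace_generated:
  assumes \<nu>: "\<nu> \<le> lam"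
  shows "is_mdspace T (reparam s) (generated \<nu>)"
proof -
  note X = mdspace[OF \<nu>]
  let ?S = "tr ozero \<nu> ` states (X ozero)" and ?t = "\<lambda>\<gamma>. compose {0..1} (tr \<nu> lam) \<gamma>"
  have "compose {0..1} \<gamma> \<phi> \<in> epaths (generated \<nu>)" if "\<gamma> \<in> epaths (generated \<nu>)" "\<phi> \<in> reparam s 1 1" for \<gamma> \<phi>
  proof -
    have "?t (compose {0..1} \<gamma> \<phi>) = compose {0..1} (?t \<gamma>) \<phi>"
      using reparam_range[OF that(2)] by (auto simp: compose_def)
    moreover have "compose {0..1} \<gamma> \<phi> \<in> epaths (X \<nu>)"
      using X that by (auto simp: is_mdspace_def generated_def)
    ultimately show ?thesis
      using that decomposable_reparam[of "?t \<gamma>" \<phi>] reparam_endpoints[OF that(2)]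
      by (auto simp: generated_def compose_eq)
  qed
  moreover have "norm_comp \<gamma>1 \<gamma>2 \<in> epaths (generated \<nu>)"
    if "\<gamma>1 \<in> epaths (generated \<nu>)" "\<gamma>2 \<in> epaths (generated \<nu>)" "\<gamma>1 1 = \<gamma>2 0" for \<gamma>1 \<gamma>2
  proof -
    have "?t (norm_comp \<gamma>1 \<gamma>2) = norm_comp (?t \<gamma>1) (?t \<gamma>2)"
      by (auto simp: compose_def norm_comp_def fun_eq_iff)
    moreover have "norm_comp \<gamma>1 \<gamma>2 \<in> epaths (X \<nu>)"
      using X that by (auto simp: is_mdspace_def generated_def)
    moreover have "norm_comp \<gamma>1 \<gamma>2 0 = \<gamma>1 0" "norm_comp \<gamma>1 \<gamma>2 1 = \<gamma>2 1"
      by (simp_all add: norm_comp_def)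
    ultimately show ?thesis
      using that decomposable_norm_comp[of "?t \<gamma>1" "?t \<gamma>2"]
      by (auto simp: generated_def compose_eq)
  qed
  moreover have "states (generated \<nu>) \<subseteq> pts (generated \<nu>)"
    using generated_sub[OF \<nu>] X by (auto simp: is_mdspace_def)
  ultimately show ?thesis
    using X unfolding is_mdspace_def by (auto simp: generated_def)
qed

lemma mdmaps_generated:
  assumes \<nu>: "\<nu> \<le> lam" and f: "f \<in> mdmaps A (X \<nu>)"
    and st: "f ` states A \<subseteq> tr ozero \<nu> ` states (X ozero)"
    and ends: "\<And>\<gamma>. \<gamma> \<in> epaths A \<Longrightarrow> \<gamma> 0 \<in> states A \<and> \<gamma> 1 \<in> states A"
    and dec: "\<And>\<gamma>. \<gamma> \<in> epaths A \<Longrightarrow> decomposable (compose {0..1} (tr \<nu> lam) (compose {0..1} f \<gamma>))"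
  shows "f \<in> mdmaps A (generated \<nu>)"
  using f st dec ends by (auto simp: mdmaps_def generated_def compose_eq)

lemma transition_generated:
  assumes "\<mu> \<le> \<nu>" "\<nu> \<le> lam"
    and IH: "states (X \<mu>) \<subseteq> states (generated \<mu>)" "epaths (X \<mu>) \<subseteq> epaths (generated \<mu>)"
  shows "tr \<mu> \<nu> \<in> mdmaps (X \<mu>) (generated \<nu>)"
proof (rule mdmaps_generated[OF assms(2) transition[OF assms(1,2)]])
  have \<mu>: "\<mu> \<le> lam" using assms by simp
  have "states (X ozero) \<subseteq> pts (X ozero)" using pre_mdspace[OF ozero_le] by (simp add: pre_mdspace_def)
  then have "tr \<mu> \<nu> (tr ozero \<mu> x) = tr ozero \<nu> x" if "x \<in> states (X ozero)" for x
    using that transition_compose[OF ozero_le assms(1,2)] by blast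
  then show "tr \<mu> \<nu> ` states (X \<mu>) \<subseteq> tr ozero \<nu> ` states (X ozero)"
    using IH(1) by (force simp: generated_def)
  fix \<gamma> assume \<gamma>: "\<gamma> \<in> epaths (X \<mu>)"
  then show "\<gamma> 0 \<in> states (X \<mu>) \<and> \<gamma> 1 \<in> states (X \<mu>)" using mdspace[OF \<mu>] by (simp add: is_mdspace_def)
  have "compose {0..1} (tr \<nu> lam) (compose {0..1} (tr \<mu> \<nu>) \<gamma>) = compose {0..1} (tr \<mu> lam) \<gamma>"
    using epath_pts[OF pre_mdspace[OF \<mu>] \<gamma>] transition_compose[OF assms(1,2) order_refl]
    by (auto simp: compose_def)
  then show "decomposable (compose {0..1} (tr \<nu> lam) (compose {0..1} (tr \<mu> \<nu>) \<gamma>))"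
    using IH(2) \<gamma> by (auto simp: generated_def)
qed

lemma decomposable_cell:
  assumes "\<nu> < lam" "z \<in> topspace (disk (dm \<nu>)) - topspace (bsphere (dm \<nu>))" and \<phi>: "\<phi> \<in> reparam s 1 1"
  shows "decomposable (compose {0..1} (gh \<nu>) (compose {0..1} (delta z) \<phi>))"
  unfolding decomposable_def
proof (intro exI conjI)
  show "traces gh [(\<nu>, z)] 1 \<phi> (compose {0..1} (gh \<nu>) (compose {0..1} (delta z) \<phi>))"
    by (simp add: traces_def compose_delta[OF \<phi>] compose_eq)
qed (use assms in \<open>auto simp: open_cells_def\<close>)

text \<open>
  An execution path of the globe over \<open>z\<close> is one piece when \<open>z\<close> is an interior point of the disk. When \<open>z\<close> is
  on the boundary, the attaching map sends it to an execution path of the previous stage, which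
  is traceable by the induction hypothesis.
\<close>

lemma cell_generated:
  assumes \<nu>: "\<nu> < lam"
    and IH: "states (X \<nu>) \<subseteq> states (generated \<nu>)" "epaths (X \<nu>) \<subseteq> epaths (generated \<nu>)"
  shows "h \<nu> \<in> mdmaps (Glob (reparam s) (disk (dm \<nu>))) (generated (osucc \<nu>))"
proof (rule mdmaps_generated[OF succ(3)[OF \<nu>] cell_map[OF \<nu>]])
  note trg = transition_generated[OF succ(2,3)[OF \<nu>] IH]
  have bd: "h \<nu> x = tr \<nu> (osucc \<nu>) (g \<nu> x)" if "x \<in> glob_set (bsphere (dm \<nu>))" for x
    using cell_map_boundary[OF \<nu> that] .
  have "g \<nu> x \<in> states (X \<nu>)" if "x \<in> {GSrc, GTgt}" for x
    using mdmaps_states[OF attach_map[OF \<nu>], of x] that by (simp add: Glob_def)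
  then have "h \<nu> x \<in> states (generated (osucc \<nu>))" if "x \<in> {GSrc, GTgt}" for x
    using that bd[of x] mdmaps_states[OF trg, of "g \<nu> x"] by auto
  then show "h \<nu> ` states (Glob (reparam s) (disk (dm \<nu>))) \<subseteq> tr ozero (osucc \<nu>) ` states (X ozero)"
    by (auto simp: Glob_def generated_def)
  fix \<gamma> assume "\<gamma> \<in> epaths (Glob (reparam s) (disk (dm \<nu>)))"
  then obtain z \<phi> where \<gamma>: "\<gamma> = compose {0..1} (delta z) \<phi>" and z: "z \<in> topspace (disk (dm \<nu>))"
    and \<phi>: "\<phi> \<in> reparam s 1 1" by (auto simp: Glob_def)
  have \<gamma>': "\<gamma> = (\<lambda>t\<in>{0..1}. glob_pt z (\<phi> t))" using \<gamma> compose_delta[OF \<phi>] by simp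
  show "\<gamma> 0 \<in> states (Glob (reparam s) (disk (dm \<nu>))) \<and> \<gamma> 1 \<in> states (Glob (reparam s) (disk (dm \<nu>)))"
    using reparam_endpoints[OF \<phi>] by (simp add: \<gamma>' Glob_def)
  show "decomposable (compose {0..1} (tr (osucc \<nu>) lam) (compose {0..1} (h \<nu>) \<gamma>))"
  proof (cases "z \<in> topspace (bsphere (dm \<nu>))")
    case True
    then have "\<gamma> \<in> epaths (Glob (reparam s) (bsphere (dm \<nu>)))" using \<gamma> \<phi> by (auto simp: Glob_def)
    then have "compose {0..1} (tr \<nu> (osucc \<nu>)) (compose {0..1} (g \<nu>) \<gamma>) \<in> epaths (generated (osucc \<nu>))"
      using mdmaps_epaths[OF attach_map[OF \<nu>]] mdmaps_epaths[OF trg] by blast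
    moreover have "compose {0..1} (h \<nu>) \<gamma> = compose {0..1} (tr \<nu> (osucc \<nu>)) (compose {0..1} (g \<nu>) \<gamma>)"
      using bd glob_pt_glob_set[OF True] reparam_range[OF \<phi>] by (auto simp: \<gamma>' compose_def)
    ultimately show ?thesis by (simp add: generated_def)
  next
    case False
    have "compose {0..1} (tr (osucc \<nu>) lam) (compose {0..1} (h \<nu>) \<gamma>) = compose {0..1} (gh \<nu>) \<gamma>"
      using gh_eq glob_pt_glob_set[OF z] reparam_range[OF \<phi>] by (auto simp: \<gamma>' compose_def)
    then show ?thesis using decomposable_cell[OF \<nu> _ \<phi>, of z] z False \<gamma> by simp
  qed
qed

lemma all_generated:
  "\<nu> \<le> lam \<Longrightarrow> states (X \<nu>) \<subseteq> states (generated \<nu>) \<and> epaths (X \<nu>) \<subseteq> epaths (generated \<nu>)"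
proof (induction \<nu> rule: less_induct)
  case (less \<nu>)
  show ?case
  proof (cases \<nu> rule: ordinal_cases)
    case zero
    have "states (X ozero) \<subseteq> pts (X ozero)" "epaths (X ozero) = {}"
      using cellular pre_mdspace[OF ozero_le] by (auto simp: cellular_def pre_mdspace_def)
    then have "tr ozero ozero x = x" if "x \<in> states (X ozero)" for x
      using transition_id[OF ozero_le] that by blast
    then show ?thesis using \<open>epaths (X ozero) = {}\<close> by (auto simp: zero generated_def image_iff)
  next
    case (succ \<mu>)
    then have \<mu>: "\<mu> < lam" "\<mu> \<le> lam" using less.prems by auto
    have IH: "states (X \<mu>) \<subseteq> states (generated \<mu>)" "epaths (X \<mu>) \<subseteq> epaths (generated \<mu>)"
      using less.IH[OF succ(1)] \<mu> by auto
    note \<nu> = less.prems[unfolded succ(2)]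
    show ?thesis
      unfolding succ(2)
      using pushout_generated[OF pushout[OF \<mu>(1)] pre_mdspace_Glob pre_mdspace[OF \<mu>(2)] mdspace[OF \<nu>]
          is_mdspace_generated[OF \<nu>] generated_sub[OF \<nu>] cell_generated[OF \<mu>(1) IH]
          transition_generated[OF _ \<nu> IH]] osucc_greater[OF \<mu>(1)]
      by auto
  next
    case limit
    have "tr \<mu> \<nu> \<in> mdmaps (X \<mu>) (generated \<nu>)" if "\<mu> < \<nu>" for \<mu>
      using transition_generated[of \<mu> \<nu>] less.IH[OF that] that less.prems by auto
    moreover have "is_mdspace T (reparam s) (X \<mu>)" if "\<mu> \<le> \<nu>" for \<mu>
      using mdspace less.prems that by simp
    moreover have "tr \<mu> \<kappa> \<in> mdmaps (X \<mu>) (X \<kappa>)" if "\<mu> \<le> \<kappa>" "\<kappa> \<le> \<nu>" for \<mu> \<kappa>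
      using transition less.prems that by simp
    ultimately show ?thesis
      using chain_colimit_generated[OF colimit[OF less.prems limit] _ _
          is_mdspace_generated[OF less.prems] generated_sub[OF less.prems]] by blast
  qed
qed

lemma states_from_zero: "\<nu> \<le> lam \<Longrightarrow> states (X \<nu>) \<subseteq> tr ozero \<nu> ` states (X ozero)"
  using all_generated by (auto simp: generated_def)

lemma epath_decomposable:
  assumes "\<gamma> \<in> epaths (X lam)"
  shows "decomposable \<gamma>"
proof -
  have "\<gamma> \<in> extensional {0..1}" 
    using pre_mdspace[OF order_refl] assms unfolding pre_mdspace_def by blast
  then have "compose {0..1} (tr lam lam) \<gamma> = \<gamma>"
    using epath_pts[OF pre_mdspace[OF order_refl] assms] transition_id[OF order_refl]
    by (auto simp: compose_def fun_eq_iff extensional_def)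
  then show ?thesis using all_generated[OF order_refl] assms by (auto simp: generated_def)
qed

end

section \<open>The real line as a test object\<close>

text \<open>
  One affine path through \<open>x\<close> already detects whether a set is a neighbourhood of \<open>x\<close>.
\<close>

lemma delta_generated_euclideanreal: "delta_generated euclideanreal"
  unfolding delta_generated_def
proof (intro allI impI)
  fix U :: "real set"
  assume U: "U \<subseteq> topspace euclideanreal \<and>
    (\<forall>p. pathin euclideanreal p \<longrightarrow> openin unit_interval {t \<in> {0..1}. p t \<in> U})"
  have "\<exists>W. open W \<and> x \<in> W \<and> W \<subseteq> U" if "x \<in> U" for x
  proof -
    \<comment> \<open>the path sweeps \<open>[x - 1, x + 1]\<close> and meets \<open>x\<close> at time \<open>1/2\<close>\<close>
    have "pathin euclideanreal (\<lambda>t. x - 1 + 2 * t)"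
      unfolding pathin_iff_path_real path_def by (intro continuous_intros)
    then have "openin unit_interval {t \<in> {0..1}. x - 1 + 2 * t \<in> U}" using U by blast
    then obtain V where V: "open V" "{t \<in> {0..1}. x - 1 + 2 * t \<in> U} = {0..1} \<inter> V"
      by (auto simp: openin_open)
    define W where "W = (\<lambda>y. (y - x + 1) / 2) -` V \<inter> {x - 1 <..< x + 1}"
    have "open W"
      unfolding W_def by (intro open_Int open_vimage V(1) open_greaterThanLessThan continuous_intros) auto
    moreover have "(1/2::real) \<in> {t \<in> {0..1}. x - 1 + 2 * t \<in> U}" using that by simp
    then have "(1/2::real) \<in> V" unfolding V(2) by blast
    then have "x \<in> W" by (simp add: W_def)
    moreover have "y \<in> U" if "y \<in> W" for y
    proof -
      have "(y - x + 1) / 2 \<in> {0..1} \<inter> V" using that by (simp add: W_def field_simps)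
      then have "x - 1 + 2 * ((y - x + 1) / 2) \<in> U" using V(2) by blast
      then show ?thesis by (simp add: field_simps)
    qed
    ultimately show ?thesis by blast
  qed
  then show "openin euclideanreal U" unfolding open_openin[symmetric] by (meson open_subopen)
qed

lemma delta_Hausdorff_euclideanreal: "delta_Hausdorff euclideanreal"
  unfolding delta_Hausdorff_def
proof (intro allI impI)
  fix p assume "pathin euclideanreal p"
  then have "compact (p ` {0..1})" by (auto simp: path_def intro: compact_continuous_image)
  then show "closedin euclideanreal (p ` {0..1})" by (simp add: compact_imp_closed)
qed

text \<open>
  All points are states and all paths are execution paths, so that a map into this object is just a continuous
  real function (\<open>mdmaps_real\<close>).
\<close>

definition real_mdspace :: "real mdspace"
  where "real_mdspace = \<lparr>under = euclideanreal, states = UNIV,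
    epaths = {\<gamma> \<in> extensional {0..1}. pathin euclideanreal \<gamma>}\<rparr>"

lemma is_mdspace_real: "is_mdspace T (reparam s) real_mdspace"
proof -
  have "in_top T euclideanreal"
    using delta_generated_euclideanreal delta_Hausdorff_euclideanreal by (cases T) auto
  moreover have "path (compose {0..1} \<gamma> \<phi>)" if "path \<gamma>" "\<phi> \<in> reparam s 1 1" for \<gamma> :: "real \<Rightarrow> real" and \<phi>
  proof -
    have "continuous_on {0..1} (\<gamma> \<circ> \<phi>)"
      using that reparam_continuous[OF that(2)] by (intro continuous_on_compose) (auto simp: path_def reparam_iff)
    then show ?thesis unfolding path_def by (rule continuous_on_eq) (simp add: compose_def)
  qed
  moreover have "path (norm_comp \<gamma>1 \<gamma>2)" if "path \<gamma>1" "path \<gamma>2" "\<gamma>1 1 = \<gamma>2 0" for \<gamma>1 \<gamma>2 :: "real \<Rightarrow> real"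
  proof -
    have "path (\<gamma>1 +++ \<gamma>2)" using that by (simp add: pathfinish_def pathstart_def)
    then show ?thesis
      unfolding path_def by (rule continuous_on_eq) (simp add: norm_comp_def joinpaths_def)
  qed
  ultimately show ?thesis
    by (simp add: is_mdspace_def real_mdspace_def compose_def norm_comp_def)
qed

lemma mdmaps_real:
  assumes X: "pre_mdspace X"
  shows "f \<in> mdmaps X real_mdspace \<longleftrightarrow> f \<in> extensional (pts X) \<and> continuous_map (under X) euclideanreal f"
proof -
  have "pathin euclideanreal (compose {0..1} f \<gamma>)"
    if f: "continuous_map (under X) euclideanreal f" and "\<gamma> \<in> epaths X" for \<gamma>
  proof -
    have "pathin (under X) \<gamma>" using X that by (auto simp: pre_mdspace_def)
    from continuous_map_compose[OF this[unfolded pathin_def] f] show ?thesis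
      unfolding pathin_def by (rule continuous_map_eq) (simp add: compose_def)
  qed
  then show ?thesis by (auto simp: mdmaps_def real_mdspace_def compose_def)
qed

lemma restrict_mdmaps_real:
  assumes "pre_mdspace X" "continuous_map (under X) euclideanreal f"
  shows "restrict f (pts X) \<in> mdmaps X real_mdspace"
  unfolding mdmaps_real[OF assms(1)] by (auto intro: continuous_map_eq[OF assms(2)])

section \<open>Real functions on globes\<close>

lemma continuous_map_from_glob:
  assumes "continuous_map (prod_topology Z unit_interval) euclideanreal (\<lambda>(z, t). f (glob_pt z t))"
  shows "continuous_map (glob_top Z) euclideanreal f"
  unfolding continuous_map_def
proof (intro conjI allI impI)
  fix U :: "real set" assume "openin euclideanreal U"
  then have "openin (prod_topology Z unit_interval)
      {x \<in> topspace (prod_topology Z unit_interval). (case x of (z, t) \<Rightarrow> f (glob_pt z t)) \<in> U}"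
    by (rule openin_continuous_map_preimage[OF assms])
  moreover have "{x \<in> topspace (prod_topology Z unit_interval). (case x of (z, t) \<Rightarrow> f (glob_pt z t)) \<in> U}
      = {(z, t). z \<in> topspace Z \<and> t \<in> {0..1} \<and> glob_pt z t \<in> {x \<in> topspace (glob_top Z). f x \<in> U}}"
    by (auto simp: topspace_glob_top intro!: glob_pt_glob_set)
  ultimately show "openin (glob_top Z) {x \<in> topspace (glob_top Z). f x \<in> U}"
    by (auto simp: openin_glob_top topspace_glob_top)
qed simp

text \<open>
  The function induced on the globe by a function \<open>K\<close> on the cylinder that is constantly \<open>a\<close> on the bottom
  and constantly \<open>b\<close> on the top.
\<close>

definition glob_fun :: "('z \<Rightarrow> real \<Rightarrow> real) \<Rightarrow> real \<Rightarrow> real \<Rightarrow> 'z globe \<Rightarrow> real"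
  where "glob_fun K a b x = (case x of GSrc \<Rightarrow> a | GTgt \<Rightarrow> b | GMid z t \<Rightarrow> K z t)"

lemma continuous_map_glob_fun:
  assumes K: "continuous_map (prod_topology Z unit_interval) euclideanreal (\<lambda>(z, t). K z t)"
    and ends: "\<And>z. z \<in> topspace Z \<Longrightarrow> K z 0 = a \<and> K z 1 = b"
  shows "\<And>z t. z \<in> topspace Z \<Longrightarrow> glob_fun K a b (glob_pt z t) = K z t"
    and "continuous_map (glob_top Z) euclideanreal (glob_fun K a b)"
proof -
  show *: "glob_fun K a b (glob_pt z t) = K z t" if "z \<in> topspace Z" for z t
    using ends[OF that] by (auto simp: glob_fun_def glob_pt_def)
  show "continuous_map (glob_top Z) euclideanreal (glob_fun K a b)"
    by (rule continuous_map_from_glob, rule continuous_map_eq[OF K]) (auto simp: *)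
qed

lemma continuous_map_disk_coordinate: "continuous_map (disk n) euclideanreal (\<lambda>x. x i)"
  unfolding disk_def Euclidean_space_def
  by (intro continuous_map_from_subtopology continuous_map_product_projection) simp

lemma bsphere_subtopology: "bsphere n = subtopology (disk n) (topspace (bsphere n))"
proof -
  have "{x. (\<Sum>i<n. x i ^ 2) \<le> 1} \<inter> topspace (bsphere n) =
      topspace (Euclidean_space n) \<inter> {x. (\<Sum>i<n. x i ^ 2) = 1}"
    by (auto simp: bsphere_def)
  then show ?thesis
    unfolding disk_def subtopology_subtopology by (simp add: bsphere_def subtopology_restrict)
qed

lemma topspace_bsphere: "topspace (bsphere n) = {x \<in> topspace (disk n). (\<Sum>i<n. x i ^ 2) = 1}"
  by (auto simp: bsphere_def disk_def)

lemma closedin_bsphere: "closedin (disk n) (topspace (bsphere n))"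
proof -
  have "continuous_map (disk n) euclideanreal (\<lambda>x. \<Sum>i<n. x i ^ 2)"
    by (intro continuous_map_sum continuous_map_real_pow continuous_map_disk_coordinate) simp
  then have "closedin (disk n) {x \<in> topspace (disk n). (\<Sum>i<n. x i ^ 2) \<in> {1}}"
    by (rule closedin_continuous_map_preimage) simp
  then show ?thesis unfolding topspace_bsphere by simp
qed

text \<open>
  Tietze's theorem is applied on the cylinder over the disk, which is metrizable, to the closed
  cylinder over the sphere. The extension \<open>K\<close> need not be constant on the two ends of the
  cylinder, hence does not descend to the globe; the affine correction \<open>K'\<close> repairs this and vanishes
  over the sphere, where \<open>K\<close> has the right end values already.
\<close>

lemma glob_extension:
  assumes k: "continuous_map (glob_top (bsphere n)) euclideanreal k"
  obtains F where "continuous_map (glob_top (disk n)) euclideanreal F"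
    and "\<And>x. x \<in> glob_set (bsphere n) \<Longrightarrow> F x = k x"
proof -
  let ?Q = "prod_topology (disk n) unit_interval" and ?S = "topspace (bsphere n) \<times> {0..1::real}"
  define a b where "a = k GSrc" and "b = k GTgt"
  have "metrizable_space ?Q"
    by (simp add: metrizable_space_prod_topology disk_def metrizable_space_subtopology
        metrizable_Euclidean_space metrizable_space_euclidean)
  then have "normal_space ?Q" by (rule metrizable_imp_normal_space)
  moreover have "closedin ?Q ?S"
    using closedin_bsphere closedin_topspace[of unit_interval] by (simp add: closedin_prod_Times_iff)
  moreover have "continuous_map (subtopology ?Q ?S) euclideanreal (\<lambda>(z, t). k (glob_pt z t))"
  proof -
    have "subtopology ?Q ?S = prod_topology (bsphere n) unit_interval"
      by (simp add: subtopology_Times bsphere_subtopology[symmetric] subtopology_subtopology)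
    then show ?thesis
      using continuous_map_compose[OF continuous_map_glob_pt k] by (simp add: o_def split_def)
  qed
  ultimately obtain K where K: "continuous_map ?Q euclideanreal K"
    and KS: "\<And>x. x \<in> ?S \<Longrightarrow> K x = (case x of (z, t) \<Rightarrow> k (glob_pt z t))"
    using Tietze_extension_realinterval[of ?Q ?S UNIV "\<lambda>(z, t). k (glob_pt z t)"]
    by (metis empty_not_UNIV is_interval_univ subset_UNIV)
  define K' where "K' z t = K (z, t) + (1 - t) * (a - K (z, 0)) + t * (b - K (z, 1))" for z t
  have fst: "continuous_map ?Q (disk n) fst" by (rule continuous_map_fst)
  have snd: "continuous_map ?Q euclideanreal snd"
    using continuous_map_snd[of "disk n" unit_interval] by (simp add: continuous_map_in_subtopology)
  have slice: "continuous_map ?Q euclideanreal (\<lambda>x. K (fst x, c))" if "c \<in> {0..1}" for c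
  proof -
    have "continuous_map ?Q ?Q (\<lambda>x. (fst x, c))"
      using that by (simp add: continuous_map_pairwise o_def fst)
    from continuous_map_compose[OF this K] show ?thesis by (simp add: o_def)
  qed
  have "continuous_map ?Q euclideanreal (\<lambda>x. K x + (1 - snd x) * (a - K (fst x, 0)) + snd x * (b - K (fst x, 1)))"
    by (intro continuous_map_add continuous_map_real_mult continuous_map_diff K snd slice) auto
  then have "continuous_map ?Q euclideanreal (\<lambda>(z, t). K' z t)" by (simp add: K'_def split_def)
  moreover have "K' z 0 = a \<and> K' z 1 = b" for z by (simp add: K'_def)
  ultimately have F: "continuous_map (glob_top (disk n)) euclideanreal (glob_fun K' a b)"
    "\<And>z t. z \<in> topspace (disk n) \<Longrightarrow> glob_fun K' a b (glob_pt z t) = K' z t"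
    using continuous_map_glob_fun[of "disk n" K' a b] by auto
  have "glob_fun K' a b x = k x" if x: "x \<in> glob_set (bsphere n)" for x
  proof -
    consider "x = GSrc" | "x = GTgt" | z t where "x = glob_pt z t" "z \<in> topspace (bsphere n)" "t \<in> {0..1}"
      using x by (auto simp: glob_set_def)
    then show ?thesis
    proof cases
      case 3
      then have "z \<in> topspace (disk n)" by (simp add: topspace_bsphere)
      moreover have "K (z, c) = k (glob_pt z c)" if "c \<in> {0..1}" for c using KS 3 that by simp
      ultimately show ?thesis using 3 F(2) by (simp add: K'_def a_def b_def)
    qed (simp_all add: glob_fun_def a_def b_def)
  qed
  with F(1) show thesis by (rule that)
qed

text \<open>
  Positive inside the open cell, and zero on the boundary sphere and on both ends.
\<close>

definition bump :: "nat \<Rightarrow> (nat \<Rightarrow> real) \<Rightarrow> real \<Rightarrow> real"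
  where "bump n z t = (1 - (\<Sum>i<n. z i ^ 2)) * (t * (1 - t))"

lemma bump_positive:
  assumes "z \<in> topspace (disk n) - topspace (bsphere n)" "0 < t" "t < 1"
  shows "0 < bump n z t"
proof -
  have "(\<Sum>i<n. z i ^ 2) < 1" using assms(1) by (auto simp: topspace_bsphere disk_def)
  then show ?thesis using assms by (simp add: bump_def)
qed

text \<open>
  Testing with \<open>q = 1\<close> shows that the bump factors agree; dividing by them, the coordinates of the
  disk and the time coordinate separate the points.
\<close>

lemma bump_separates:
  assumes z: "z \<in> topspace (disk n) - topspace (bsphere n)" "0 < t" "t < 1"
    and z': "z' \<in> topspace (disk n) - topspace (bsphere n)" "0 < t'" "t' < 1"
    and eq: "\<And>q. continuous_map (prod_topology (disk n) unit_interval) euclideanreal (\<lambda>(z, t). q z t) \<Longrightarrow>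
      bump n z t * q z t = bump n z' t' * q z' t'"
  shows "z = z' \<and> t = t'"
proof -
  have one: "bump n z t = bump n z' t'" using eq[of "\<lambda>_ _. 1"] by (simp add: split_def)
  then have q: "q z t = q z' t'"
    if "continuous_map (prod_topology (disk n) unit_interval) euclideanreal (\<lambda>(z, t). q z t)" for q
    using eq[OF that] bump_positive[OF z] by simp
  have "continuous_map (prod_topology (disk n) unit_interval) euclideanreal snd"
    using continuous_map_snd[of "disk n" unit_interval] by (simp add: continuous_map_in_subtopology)
  then have "t = t'" using q[of "\<lambda>z t. t"] by (simp add: split_def)
  moreover have "z i = z' i" for i
  proof -
    have "continuous_map (prod_topology (disk n) unit_interval) euclideanreal (\<lambda>x. fst x i)"
      using continuous_map_compose[OF continuous_map_fst continuous_map_disk_coordinate] by (simp add: o_def)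
    then show ?thesis using q[of "\<lambda>z t. z i"] by (simp add: split_def)
  qed
  ultimately show ?thesis by blast
qed

section \<open>Extension of real functions over the cells\<close>

context cellular_mdspace
begin

text \<open>
  The pushout property, tested on the real line. A real number \<open>r\<close> is coded in the disjoint sum of the
  two types of points by the globe point at time \<open>r\<close> over the origin.
\<close>

lemma extend_over_cell:
  assumes \<nu>: "\<nu> < lam"
    and F: "continuous_map (glob_top (disk (dm \<nu>))) euclideanreal F"
    and f: "continuous_map (under (X \<nu>)) euclideanreal f"
    and eq: "\<And>x. x \<in> glob_set (bsphere (dm \<nu>)) \<Longrightarrow> F x = f (g \<nu> x)"
  obtains w where "continuous_map (under (X (osucc \<nu>))) euclideanreal w"
    and "\<And>x. x \<in> glob_set (disk (dm \<nu>)) \<Longrightarrow> w (h \<nu> x) = F x"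
    and "\<And>x. x \<in> pts (X \<nu>) \<Longrightarrow> w (tr \<nu> (osucc \<nu>) x) = f x"
proof -
  let ?B = "Glob (reparam s) (disk (dm \<nu>))" and ?A = "Glob (reparam s) (bsphere (dm \<nu>))"
  have X: "pre_mdspace (X \<nu>)" "pre_mdspace (X (osucc \<nu>))" using \<nu> succ[OF \<nu>] by (auto intro: pre_mdspace)
  have inj: "inj_on (\<lambda>r. Inl (GMid (\<lambda>_. 0) r) :: (nat \<Rightarrow> real) globe + 'a) (pts real_mdspace)"
    by (simp add: inj_on_def)
  have u: "restrict F (glob_set (disk (dm \<nu>))) \<in> mdmaps ?B real_mdspace"
    using restrict_mdmaps_real[OF pre_mdspace_Glob[of s "disk (dm \<nu>)"], of F] F by (simp add: Glob_def topspace_glob_top)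
  have v: "restrict f (pts (X \<nu>)) \<in> mdmaps (X \<nu>) real_mdspace"
    by (rule restrict_mdmaps_real[OF X(1) f])
  have "glob_set (bsphere (dm \<nu>)) \<subseteq> glob_set (disk (dm \<nu>))"
    by (auto simp: glob_set_def topspace_bsphere)
  then have "\<forall>a\<in>pts ?A. restrict F (glob_set (disk (dm \<nu>))) (glob_incl (reparam s) (dm \<nu>) a) =
      restrict f (pts (X \<nu>)) (g \<nu> a)"
    using eq mdmaps_pts[OF attach_map[OF \<nu>]] by (auto simp: glob_incl_def)
  from pushout_universal(1)[OF pushout[OF \<nu>] pre_mdspace_Glob X is_mdspace_real inj u v this]
  obtain w where "w \<in> mdmaps (X (osucc \<nu>)) real_mdspace"
    "\<And>x. x \<in> glob_set (disk (dm \<nu>)) \<Longrightarrow> w (h \<nu> x) = F x"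
    "\<And>x. x \<in> pts (X \<nu>) \<Longrightarrow> w (tr \<nu> (osucc \<nu>) x) = f x"
    by auto
  then show thesis using that mdmaps_real[OF X(2)] by blast
qed

lemma cell_function:
  assumes \<nu>: "\<nu> < lam"
    and q: "continuous_map (prod_topology (disk (dm \<nu>)) unit_interval) euclideanreal (\<lambda>(z, t). q z t)"
  obtains w where "continuous_map (under (X (osucc \<nu>))) euclideanreal w"
    and "\<And>z t. z \<in> topspace (disk (dm \<nu>)) \<Longrightarrow> t \<in> {0..1} \<Longrightarrow>
      w (h \<nu> (glob_pt z t)) = bump (dm \<nu>) z t * q z t"
    and "\<And>x. x \<in> pts (X \<nu>) \<Longrightarrow> w (tr \<nu> (osucc \<nu>) x) = 0"
proof -
  let ?Q = "prod_topology (disk (dm \<nu>)) unit_interval"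
  let ?K = "\<lambda>z t. bump (dm \<nu>) z t * q z t"
  have fst: "continuous_map ?Q euclideanreal (\<lambda>x. fst x i)" for i
    using continuous_map_compose[OF continuous_map_fst continuous_map_disk_coordinate] by (simp add: o_def)
  have snd: "continuous_map ?Q euclideanreal snd"
    using continuous_map_snd[of "disk (dm \<nu>)" unit_interval] by (simp add: continuous_map_in_subtopology)
  have "continuous_map ?Q euclideanreal (\<lambda>x. bump (dm \<nu>) (fst x) (snd x))"
    unfolding bump_def
    by (intro continuous_map_real_mult continuous_map_diff continuous_map_sum continuous_map_real_pow fst snd) auto
  then have K: "continuous_map ?Q euclideanreal (\<lambda>(z, t). ?K z t)"
    using q by (auto simp: split_def intro: continuous_map_real_mult)
  have "?K z 0 = 0 \<and> ?K z 1 = 0" for z by (simp add: bump_def)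
  note F = continuous_map_glob_fun[OF K this]
  have "glob_fun ?K 0 0 x = 0" if "x \<in> glob_set (bsphere (dm \<nu>))" for x
    using that by (auto simp: glob_set_def glob_fun_def glob_pt_def bump_def topspace_bsphere)
  then obtain w where w: "continuous_map (under (X (osucc \<nu>))) euclideanreal w"
    "\<And>x. x \<in> glob_set (disk (dm \<nu>)) \<Longrightarrow> w (h \<nu> x) = glob_fun ?K 0 0 x"
    "\<And>x. x \<in> pts (X \<nu>) \<Longrightarrow> w (tr \<nu> (osucc \<nu>) x) = 0"
    using extend_over_cell[OF \<nu> F(2), of "\<lambda>_. 0"] by auto
  have "w (h \<nu> (glob_pt z t)) = bump (dm \<nu>) z t * q z t"
    if "z \<in> topspace (disk (dm \<nu>))" "t \<in> {0..1}" for z t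
    using w(2)[OF glob_pt_glob_set[OF that]] F(1)[OF that(1)] by simp
  then show thesis by (rule that[OF w(1) _ w(3)])
qed

lemma cell_map_inj:
  assumes \<nu>: "\<nu> < lam"
    and z: "z \<in> topspace (disk (dm \<nu>)) - topspace (bsphere (dm \<nu>))" "0 < t" "t < 1"
    and z': "z' \<in> topspace (disk (dm \<nu>)) - topspace (bsphere (dm \<nu>))" "0 < t'" "t' < 1"
    and eq: "h \<nu> (glob_pt z t) = h \<nu> (glob_pt z' t')"
  shows "z = z' \<and> t = t'"
proof (rule bump_separates[OF z z'])
  fix q assume "continuous_map (prod_topology (disk (dm \<nu>)) unit_interval) euclideanreal (\<lambda>(z, t). q z t)"
  from cell_function[OF \<nu> this] show "bump (dm \<nu>) z t * q z t = bump (dm \<nu>) z' t' * q z' t'"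
    using z z' eq by (metis DiffD1 atLeastAtMost_iff less_eq_real_def)
qed

text \<open>
  At a limit stage the test objects are carried by pairs of an index and a point, so the real line is
  admissible only if the type of points is large enough. It is as soon as there is one cell,
  since an open interval of times embeds by \<open>cell_map_inj\<close>.
\<close>

lemma real_inj:
  assumes "\<nu> < lam"
  obtains \<iota> :: "real \<Rightarrow> 'a" where "inj \<iota>"
proof -
  \<comment> \<open>\<open>?e\<close> maps the reals injectively into the times strictly between \<open>0\<close> and \<open>1\<close>\<close>
  let ?z = "\<lambda>_. 0 :: real" and ?e = "\<lambda>x. 1/2 + arctan x / pi"
  have z: "?z \<in> topspace (disk (dm \<nu>)) - topspace (bsphere (dm \<nu>))"
    by (simp add: disk_def bsphere_def topspace_Euclidean_space)
  have e: "0 < ?e x" "?e x < 1" for x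
    using arctan_bounded[of x] by (auto simp: field_simps)
  have "inj (\<lambda>x. h \<nu> (glob_pt ?z (?e x)))"
  proof (rule injI)
    fix x y assume "h \<nu> (glob_pt ?z (?e x)) = h \<nu> (glob_pt ?z (?e y))"
    then have "?e x = ?e y" using cell_map_inj[OF assms z e z e] by blast
    then show "x = y" by (simp add: arctan_eq_iff)
  qed
  then show thesis by (rule that)
qed

lemma extend_succ:
  assumes \<nu>: "\<nu> < lam" and f: "continuous_map (under (X \<nu>)) euclideanreal f"
  obtains w where "continuous_map (under (X (osucc \<nu>))) euclideanreal w"
    and "\<And>x. x \<in> pts (X \<nu>) \<Longrightarrow> w (tr \<nu> (osucc \<nu>) x) = f x"
proof -
  have "continuous_map (glob_top (bsphere (dm \<nu>))) (under (X \<nu>)) (g \<nu>)"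
    using mdmaps_continuous[OF attach_map[OF \<nu>]] by (simp add: Glob_def)
  from glob_extension[OF continuous_map_compose[OF this f]]
  obtain F where "continuous_map (glob_top (disk (dm \<nu>))) euclideanreal F"
    "\<And>x. x \<in> glob_set (bsphere (dm \<nu>)) \<Longrightarrow> F x = (f \<circ> g \<nu>) x"
    by blast
  with extend_over_cell[OF \<nu> _ f] obtain w where
    "continuous_map (under (X (osucc \<nu>))) euclideanreal w"
    "\<And>x. x \<in> pts (X \<nu>) \<Longrightarrow> w (tr \<nu> (osucc \<nu>) x) = f x"
    by (metis comp_apply)
  then show thesis by (rule that)
qed

text \<open>
  The functions are given from stage \<open>\<nu>\<close> on. Below \<open>\<nu>\<close> the cocone is completed by pulling back from \<open>\<nu>\<close>; the
  index \<open>max \<nu> \<mu>\<close> treats both ranges at once.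
\<close>

lemma extend_limit:
  assumes \<kappa>: "\<kappa> \<le> lam" "olimit \<kappa>" and \<nu>: "\<nu> < \<kappa>"
    and f: "\<And>\<mu>. \<nu> \<le> \<mu> \<Longrightarrow> \<mu> < \<kappa> \<Longrightarrow> continuous_map (under (X \<mu>)) euclideanreal (f \<mu>)"
    and comp: "\<And>\<mu> \<mu>' x. \<nu> \<le> \<mu> \<Longrightarrow> \<mu> \<le> \<mu>' \<Longrightarrow> \<mu>' < \<kappa> \<Longrightarrow> x \<in> pts (X \<mu>) \<Longrightarrow> f \<mu>' (tr \<mu> \<mu>' x) = f \<mu> x"
  obtains w where "continuous_map (under (X \<kappa>)) euclideanreal w"
    and "\<And>\<mu> x. \<nu> \<le> \<mu> \<Longrightarrow> \<mu> < \<kappa> \<Longrightarrow> x \<in> pts (X \<mu>) \<Longrightarrow> w (tr \<mu> \<kappa> x) = f \<mu> x"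
proof -
  have "\<nu> < lam" using \<kappa> \<nu> by simp
  then obtain \<iota> :: "real \<Rightarrow> 'a" where "inj \<iota>" by (rule real_inj)
  then have inj: "inj_on (\<lambda>r. (undefined :: 'i, \<iota> r)) (pts real_mdspace)"
    by (auto simp: inj_on_def)
  define u where "u \<mu> = (\<lambda>x\<in>pts (X \<mu>). f (max \<nu> \<mu>) (tr \<mu> (max \<nu> \<mu>) x))" for \<mu>
  have u: "u \<mu> \<in> mdmaps (X \<mu>) real_mdspace" if "\<mu> < \<kappa>" for \<mu>
  proof -
    have m: "max \<nu> \<mu> < \<kappa>" "max \<nu> \<mu> \<le> lam" "\<mu> \<le> lam" using that \<nu> \<kappa> by auto
    have "continuous_map (under (X \<mu>)) euclideanreal (f (max \<nu> \<mu>) \<circ> tr \<mu> (max \<nu> \<mu>))"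
      by (rule continuous_map_compose[OF mdmaps_continuous[OF transition] f]) (use m in auto)
    from restrict_mdmaps_real[OF pre_mdspace[OF m(3)] this] show ?thesis by (simp add: u_def o_def)
  qed
  have compat: "u \<mu>' (tr \<mu> \<mu>' x) = u \<mu> x" if "\<mu> \<le> \<mu>'" "\<mu>' < \<kappa>" "x \<in> pts (X \<mu>)" for \<mu> \<mu>' x
  proof -
    let ?m = "max \<nu> \<mu>" and ?m' = "max \<nu> \<mu>'"
    have m: "\<mu> \<le> ?m" "?m \<le> ?m'" "\<mu>' \<le> ?m'" "?m' < \<kappa>" "?m' \<le> lam" "\<mu>' \<le> lam" "?m \<le> lam"
      using that \<nu> \<kappa> by (auto simp: le_max_iff_disj)
    have "u \<mu>' (tr \<mu> \<mu>' x) = f ?m' (tr \<mu>' ?m' (tr \<mu> \<mu>' x))"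
      using mdmaps_pts[OF transition[OF that(1) m(6)] that(3)] by (simp add: u_def)
    also have "tr \<mu>' ?m' (tr \<mu> \<mu>' x) = tr ?m ?m' (tr \<mu> ?m x)"
      using transition_compose that m by (metis order.trans)
    also have "f ?m' \<dots> = f ?m (tr \<mu> ?m x)"
      using mdmaps_pts[OF transition[OF m(1) m(7)] that(3)] m by (intro comp) auto
    finally show ?thesis using that by (simp add: u_def)
  qed
  have X: "pre_mdspace (X \<mu>)" if "\<mu> \<le> \<kappa>" for \<mu> using pre_mdspace that \<kappa> by auto
  have tr: "tr \<mu> \<mu>' \<in> mdmaps (X \<mu>) (X \<mu>')" if "\<mu> \<le> \<mu>'" "\<mu>' \<le> \<kappa>" for \<mu> \<mu>'
    using transition that \<kappa> by auto
  obtain w where w: "w \<in> mdmaps (X \<kappa>) real_mdspace" "\<forall>\<mu><\<kappa>. \<forall>x\<in>pts (X \<mu>). w (tr \<mu> \<kappa> x) = u \<mu> x"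
    using chain_colimit_universal(1)[OF colimit[OF \<kappa>] X tr is_mdspace_real inj u compat] by blast
  show thesis
  proof (rule that)
    show "continuous_map (under (X \<kappa>)) euclideanreal w" using w(1) mdmaps_real[OF X] by blast
    fix \<mu> x assume "\<nu> \<le> \<mu>" "\<mu> < \<kappa>" "x \<in> pts (X \<mu>)"
    moreover from this have "\<mu> \<le> lam" using \<kappa> by auto
    ultimately show "w (tr \<mu> \<kappa> x) = f \<mu> x"
      using w(2) transition_id by (simp add: u_def max_absorb2)
  qed
qed

text \<open>
  Extensions over a single cell are not unique, so a coherent family is chosen by well-founded
  recursion: \<open>P f \<kappa> r\<close> says that \<open>r\<close> is an admissible value at stage \<open>\<kappa>\<close> given the values \<open>f \<mu>\<close> at the earlier
  stages.
\<close>

lemma extend_to_lam: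
  assumes \<nu>: "\<nu> \<le> lam" and f0: "continuous_map (under (X \<nu>)) euclideanreal f0"
  obtains w where "continuous_map (under (X lam)) euclideanreal w"
    and "\<And>x. x \<in> pts (X \<nu>) \<Longrightarrow> w (tr \<nu> lam x) = f0 x"
proof -
  define P where "P f \<kappa> r \<longleftrightarrow> (\<nu> \<le> \<kappa> \<and> \<kappa> \<le> lam \<longrightarrow> continuous_map (under (X \<kappa>)) euclideanreal r \<and>
    (\<kappa> = \<nu> \<longrightarrow> r = f0) \<and> (\<forall>\<mu>. \<nu> \<le> \<mu> \<and> \<mu> < \<kappa> \<longrightarrow> (\<forall>x\<in>pts (X \<mu>). r (tr \<mu> \<kappa> x) = f \<mu> x)))"
    for f :: "'i \<Rightarrow> 'a \<Rightarrow> real" and \<kappa> r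
  have "\<exists>f. \<forall>\<kappa>. P f \<kappa> (f \<kappa>)"
  proof (rule dependent_wellorder_choice)
    fix r :: "'a \<Rightarrow> real" and f g' :: "'i \<Rightarrow> 'a \<Rightarrow> real" and \<kappa> :: 'i
    assume "\<And>\<mu>. \<mu> < \<kappa> \<Longrightarrow> f \<mu> = g' \<mu>"
    then show "P f \<kappa> r = P g' \<kappa> r" by (simp add: P_def)
  next
    fix \<kappa> :: 'i and f :: "'i \<Rightarrow> 'a \<Rightarrow> real" assume IH: "\<And>\<mu>. \<mu> < \<kappa> \<Longrightarrow> P f \<mu> (f \<mu>)"
    show "\<exists>r. P f \<kappa> r"
    proof (cases "\<nu> < \<kappa> \<and> \<kappa> \<le> lam")
      case False
      then show ?thesis using f0 by (intro exI[of _ f0]) (auto simp: P_def)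
    next
      case True
      have cont: "continuous_map (under (X \<mu>)) euclideanreal (f \<mu>)" if "\<nu> \<le> \<mu>" "\<mu> < \<kappa>" for \<mu>
        using IH[OF that(2)] that True by (auto simp: P_def)
      have comp: "f \<mu>' (tr \<mu> \<mu>' x) = f \<mu> x" if "\<nu> \<le> \<mu>" "\<mu> \<le> \<mu>'" "\<mu>' < \<kappa>" "x \<in> pts (X \<mu>)" for \<mu> \<mu>' x
      proof (cases "\<mu> = \<mu>'")
        case eq: True
        then show ?thesis using transition_id[of \<mu> x] that True by auto
      next
        case False
        then show ?thesis using IH[OF that(3)] that True unfolding P_def by auto
      qed
      show ?thesis
      proof (cases \<kappa> rule: ordinal_cases)
        case zero
        then show ?thesis using True ozero_le[of \<nu>] by (simp add: not_less[symmetric])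
      next
        case (succ \<mu>)
        have \<mu>: "\<mu> < lam" "\<nu> \<le> \<mu>" using succ True osucc_le[of \<mu> \<nu>] by (auto simp: not_less[symmetric])
        obtain w where w: "continuous_map (under (X (osucc \<mu>))) euclideanreal w"
          "\<And>x. x \<in> pts (X \<mu>) \<Longrightarrow> w (tr \<mu> (osucc \<mu>) x) = f \<mu> x"
          using extend_succ[OF \<mu>(1) cont[OF \<mu>(2) succ(1)]] by blast
        have "w (tr \<mu>' \<kappa> x) = f \<mu>' x" if "\<nu> \<le> \<mu>'" "\<mu>' < \<kappa>" "x \<in> pts (X \<mu>')" for \<mu>' x
        proof -
          have le: "\<mu>' \<le> \<mu>" using that(2) succ osucc_le[of \<mu> \<mu>'] by (auto simp: not_less[symmetric])
          have "w (tr \<mu>' \<kappa> x) = w (tr \<mu> \<kappa> (tr \<mu>' \<mu> x))"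
            using transition_compose[OF le _ _ that(3), of \<kappa>] succ True by simp
          also have "\<dots> = f \<mu> (tr \<mu>' \<mu> x)"
            using w(2) mdmaps_pts[OF transition[OF le] that(3)] \<mu> succ(2) by simp
          also have "\<dots> = f \<mu>' x" using comp[OF that(1) le succ(1) that(3)] .
          finally show ?thesis .
        qed
        then show ?thesis using w(1) True succ(2) by (intro exI[of _ w]) (auto simp: P_def)
      next
        case limit
        obtain w where "continuous_map (under (X \<kappa>)) euclideanreal w"
          "\<And>\<mu> x. \<nu> \<le> \<mu> \<Longrightarrow> \<mu> < \<kappa> \<Longrightarrow> x \<in> pts (X \<mu>) \<Longrightarrow> w (tr \<mu> \<kappa> x) = f \<mu> x"
          using extend_limit[OF _ limit _ cont comp] True by blast
        then show ?thesis using True by (intro exI[of _ w]) (auto simp: P_def)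
      qed
    qed
  qed
  then obtain f where f: "\<And>\<kappa>. P f \<kappa> (f \<kappa>)" by blast
  have f\<nu>: "f \<nu> = f0" using f[of \<nu>] \<nu> by (simp add: P_def)
  show thesis
  proof (rule that)
    show "continuous_map (under (X lam)) euclideanreal (f lam)" using f[of lam] \<nu> by (simp add: P_def)
    fix x assume x: "x \<in> pts (X \<nu>)"
    show "f lam (tr \<nu> lam x) = f0 x"
    proof (cases "\<nu> = lam")
      case True
      then show ?thesis using f\<nu> transition_id x by simp
    next
      case False
      then have "f lam (tr \<nu> lam x) = f \<nu> x" using f[of lam] \<nu> x unfolding P_def by (simp add: less_le)
      then show ?thesis by (simp add: f\<nu>)
    qed
  qed
qed

end

section \<open>Uniqueness of decompositions\<close>

lemma integer_valued_continuous_constant: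
  fixes f :: "real \<Rightarrow> real"
  assumes "continuous_on {a..b} f" and "\<And>t. t \<in> {a..b} \<Longrightarrow> f t \<in> \<int>" and "x \<in> {a..b}" "y \<in> {a..b}"
  shows "f x = f y"
proof -
  have "1 \<le> norm (f v - f u)" if "u \<in> {a..b}" "v \<in> {a..b}" "f v \<noteq> f u" for u v
  proof -
    have "f v - f u \<in> \<int>" using assms(2) that by (intro Ints_diff)
    then show ?thesis using Ints_nonzero_abs_ge1[of "f v - f u"] that by simp
  qed
  then have "f constant_on {a..b}"
    using assms(1) by (intro continuous_discrete_range_constant) (auto intro!: exI[of _ 1])
  then show ?thesis using assms(3,4) by (auto simp: constant_on_def)
qed

lemma unit_subinterval:
  assumes "0 \<le> x" "x \<le> real n" "0 < n"
  obtains i where "i < n" "real i \<le> x" "x \<le> real i + 1"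
proof (cases "x = real n")
  case True
  then show thesis using that[of "n - 1"] assms(3) by (simp add: of_nat_diff)
next
  case False
  then have "nat \<lfloor>x\<rfloor> < n" using assms by linarith
  then show thesis using that[of "nat \<lfloor>x\<rfloor>"] assms by linarith
qed

context cellular_mdspace
begin

lemma cell_function_lam:
  assumes \<nu>: "\<nu> < lam"
    and q: "continuous_map (prod_topology (disk (dm \<nu>)) unit_interval) euclideanreal (\<lambda>(z, t). q z t)"
  obtains w :: "'a \<Rightarrow> real"
  where "\<And>z t. z \<in> topspace (disk (dm \<nu>)) \<Longrightarrow> t \<in> {0..1} \<Longrightarrow>
      w (gh \<nu> (glob_pt z t)) = bump (dm \<nu>) z t * q z t"
    and "\<And>\<mu> x. \<mu> \<le> \<nu> \<Longrightarrow> x \<in> pts (X \<mu>) \<Longrightarrow> w (tr \<mu> lam x) = 0"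
proof -
  note su = succ[OF \<nu>]
  obtain f where f: "continuous_map (under (X (osucc \<nu>))) euclideanreal f"
    "\<And>z t. z \<in> topspace (disk (dm \<nu>)) \<Longrightarrow> t \<in> {0..1} \<Longrightarrow> f (h \<nu> (glob_pt z t)) = bump (dm \<nu>) z t * q z t"
    "\<And>x. x \<in> pts (X \<nu>) \<Longrightarrow> f (tr \<nu> (osucc \<nu>) x) = 0"
    using cell_function[OF \<nu> q] by blast
  obtain w where w: "\<And>x. x \<in> pts (X (osucc \<nu>)) \<Longrightarrow> w (tr (osucc \<nu>) lam x) = f x"
    using extend_to_lam[OF su(3) f(1)] by blast
  show thesis
  proof (rule that)
    fix z t assume zt: "z \<in> topspace (disk (dm \<nu>))" "t \<in> {0..1::real}"
    then have "glob_pt z t \<in> glob_set (disk (dm \<nu>))" by (rule glob_pt_glob_set)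
    then show "w (gh \<nu> (glob_pt z t)) = bump (dm \<nu>) z t * q z t"
      using w mdmaps_pts[OF cell_map[OF \<nu>]] f(2)[OF zt] by (simp add: gh_eq)
  next
    fix \<mu> x assume \<mu>: "\<mu> \<le> \<nu>" and x: "x \<in> pts (X \<mu>)"
    have y: "tr \<mu> \<nu> x \<in> pts (X \<nu>)" using mdmaps_pts[OF transition[OF \<mu>] x] \<nu> by simp
    have "tr \<mu> lam x = tr (osucc \<nu>) lam (tr \<nu> (osucc \<nu>) (tr \<mu> \<nu> x))"
      using transition_compose[OF \<mu> _ _ x] transition_compose[OF su(2,3) order_refl y] \<nu> by simp
    then show "w (tr \<mu> lam x) = 0"
      using w mdmaps_pts[OF transition[OF su(2,3)] y] f(3)[OF y] by simp
  qed
qed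

text \<open>
  An interior point of a cell is separated from everything present before that cell was attached, by the bump
  function of the cell.
\<close>

lemma open_cell_new:
  assumes \<nu>: "\<nu> < lam" and z: "z \<in> topspace (disk (dm \<nu>)) - topspace (bsphere (dm \<nu>))" "0 < t" "t < 1"
    and \<mu>: "\<mu> \<le> \<nu>" and x: "x \<in> pts (X \<mu>)"
  shows "gh \<nu> (glob_pt z t) \<noteq> tr \<mu> lam x"
proof -
  have "continuous_map (prod_topology (disk (dm \<nu>)) unit_interval) euclideanreal (\<lambda>(z, t). 1)"
    by (simp add: split_def)
  from cell_function_lam[OF \<nu> this] obtain w :: "'a \<Rightarrow> real"
    where w: "w (gh \<nu> (glob_pt z t)) = bump (dm \<nu>) z t * 1" "w (tr \<mu> lam x) = 0"
    using z \<mu> x by (metis DiffD1 atLeastAtMost_iff less_eq_real_def)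
  then show ?thesis using bump_positive[OF z] by force
qed

text \<open>
  For different cells, the later one is separated from the earlier one as a new cell; within one cell the
  bump functions separate the points.
\<close>

lemma open_cells_disjoint:
  assumes \<nu>: "\<nu> < lam" and \<nu>': "\<nu>' < lam"
    and z: "z \<in> topspace (disk (dm \<nu>)) - topspace (bsphere (dm \<nu>))" "0 < t" "t < 1"
    and z': "z' \<in> topspace (disk (dm \<nu>')) - topspace (bsphere (dm \<nu>'))" "0 < t'" "t' < 1"
    and eq: "gh \<nu> (glob_pt z t) = gh \<nu>' (glob_pt z' t')"
  shows "\<nu> = \<nu>' \<and> z = z' \<and> t = t'"
proof -
  have later: False
    if "\<nu> < \<nu>'" "\<nu>' < lam" "z \<in> topspace (disk (dm \<nu>))" "t \<in> {0..1}"
      "z' \<in> topspace (disk (dm \<nu>')) - topspace (bsphere (dm \<nu>'))" "0 < t'" "t' < 1"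
      "gh \<nu>' (glob_pt z' t') = gh \<nu> (glob_pt z t)" for \<nu> \<nu>' z z' t t'
  proof -
    have \<nu>: "\<nu> < lam" using that by simp
    have pt: "glob_pt z t \<in> glob_set (disk (dm \<nu>))" using that by (intro glob_pt_glob_set)
    have "h \<nu> (glob_pt z t) \<in> pts (X (osucc \<nu>))" using mdmaps_pts[OF cell_map[OF \<nu>]] pt by simp
    from open_cell_new[OF that(2,5-7) osucc_le[OF that(1)] this]
    show False using that(8) gh_eq[OF pt] by simp
  qed
  have "\<nu> = \<nu>'"
    using later[OF _ \<nu>' _ _ z' eq[symmetric]] later[OF _ \<nu> _ _ z eq] z z' by (cases rule: linorder_cases[of \<nu> \<nu>']) auto
  moreover have "z = z' \<and> t = t'"
  proof (rule bump_separates[OF z z'[folded \<open>\<nu> = \<nu>'\<close>]])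
    fix q assume "continuous_map (prod_topology (disk (dm \<nu>)) unit_interval) euclideanreal (\<lambda>(z, t). q z t)"
    from cell_function_lam[OF \<nu> this] show "bump (dm \<nu>) z t * q z t = bump (dm \<nu>) z' t' * q z' t'"
      using z z' eq \<open>\<nu> = \<nu>'\<close> by (metis DiffD1 atLeastAtMost_iff less_eq_real_def)
  qed
  ultimately show ?thesis by simp
qed

text \<open>
  The attaching maps may glue the ends of a cell to any states, but these all come from the first
  stage, which no cell interior meets.
\<close>

lemma globe_end_state:
  assumes \<nu>: "\<nu> < lam" and x: "x \<in> {GSrc, GTgt}"
  shows "gh \<nu> x \<in> tr ozero lam ` states (X ozero)"
proof -
  have "h \<nu> x \<in> states (X (osucc \<nu>))"
    using mdmaps_states[OF cell_map[OF \<nu>]] x by (auto simp: Glob_def)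
  then have "tr (osucc \<nu>) lam (h \<nu> x) \<in> states (X lam)"
    using mdmaps_states[OF transition[OF succ(3)[OF \<nu>] order_refl]] by blast
  moreover have "gh \<nu> x = tr (osucc \<nu>) lam (h \<nu> x)" using x by (intro gh_eq) auto
  ultimately show ?thesis using states_from_zero[OF order_refl] by auto
qed

text \<open>
  The ends of a cell come from states of the first stage, so they lie in no cell interior; the interiors of the
  cells are disjoint.
\<close>

lemma globe_point_determined:
  assumes c: "(\<nu>, z) \<in> open_cells lam dm" "(\<nu>', z') \<in> open_cells lam dm"
    and t: "t \<in> {0..1}" "t' \<in> {0..1}" and eq: "gh \<nu> (glob_pt z t) = gh \<nu>' (glob_pt z' t')"
  shows "t \<in> {0, 1} \<and> t' \<in> {0, 1} \<or> \<nu> = \<nu>' \<and> z = z' \<and> t = t'"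
proof -
  have ends: "t' \<in> {0, 1}"
    if "(\<nu>, z) \<in> open_cells lam dm" "(\<nu>', z') \<in> open_cells lam dm" "t \<in> {0, 1}" "t' \<in> {0..1}"
      "gh \<nu> (glob_pt z t) = gh \<nu>' (glob_pt z' t')" for \<nu> \<nu>' z z' t t'
  proof (rule ccontr)
    note hyp = that
    assume "t' \<notin> {0, 1}"
    then have t': "0 < t'" "t' < 1" using that by auto
    have "gh \<nu> (glob_pt z t) \<in> tr ozero lam ` states (X ozero)"
    proof (rule globe_end_state)
      show "\<nu> < lam" using that(1) by (simp add: open_cells_def)
      show "glob_pt z t \<in> {GSrc, GTgt}" using that(3) by auto
    qed
    then obtain x where "x \<in> pts (X ozero)" "gh \<nu>' (glob_pt z' t') = tr ozero lam x"
      using hyp(5) pre_mdspace[OF ozero_le] by (auto simp: pre_mdspace_def)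
    then show False
      using open_cell_new[OF _ _ t' ozero_le] that(2) by (auto simp: open_cells_def)
  qed
  show ?thesis
  proof (cases "t \<in> {0, 1} \<or> t' \<in> {0, 1}")
    case True
    then show ?thesis using ends[OF c _ t(2) eq] ends[OF c(2,1) _ t(1) eq[symmetric]] by auto
  next
    case False
    then show ?thesis
      using open_cells_disjoint[of \<nu> \<nu>' z t z' t'] c t eq by (auto simp: open_cells_def)
  qed
qed

text \<open>
  The two parameters differ by an integer at each time, hence by a constant, hence not at all. The \<open>i\<close>-th letter is
  read off when the parameter is \<open>i + 1/2\<close>, well inside the cell.
\<close>

lemma traces_unique:
  assumes ws: "set ws \<subseteq> open_cells lam dm" "ws \<noteq> []" and ws': "set ws' \<subseteq> open_cells lam dm" "ws' \<noteq> []"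
    and re: "\<psi> \<in> reparam s 1 (length ws)" and re': "\<psi>' \<in> reparam s 1 (length ws')"
    and tr: "traces gh ws 1 \<psi> \<gamma>" and tr': "traces gh ws' 1 \<psi>' \<gamma>"
  shows "\<psi> = \<psi>'" and "ws = ws'"
proof -
  have meet: "\<psi> t - real i \<in> {0, 1} \<and> \<psi>' t - real i' \<in> {0, 1} \<or>
      ws ! i = ws' ! i' \<and> \<psi> t - real i = \<psi>' t - real i'"
    if t: "t \<in> {0..1}" and i: "i < length ws" "real i \<le> \<psi> t" "\<psi> t \<le> real i + 1"
      and i': "i' < length ws'" "real i' \<le> \<psi>' t" "\<psi>' t \<le> real i' + 1" for t i i'
  proof -
    have "ws ! i \<in> open_cells lam dm" "ws' ! i' \<in> open_cells lam dm" using ws ws' i i' nth_mem by blast+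
    moreover have "gh (fst (ws ! i)) (glob_pt (snd (ws ! i)) (\<psi> t - real i)) =
        gh (fst (ws' ! i')) (glob_pt (snd (ws' ! i')) (\<psi>' t - real i'))"
      using tracesD[OF tr _ _ i] tracesD[OF tr' _ _ i'] t by simp
    ultimately show ?thesis
      using globe_point_determined[of "fst (ws ! i)" "snd (ws ! i)" "fst (ws' ! i')" "snd (ws' ! i')"
          "\<psi> t - real i" "\<psi>' t - real i'"] i i' by (auto simp: prod_eq_iff)
  qed
  have Ints: "\<psi> t - \<psi>' t \<in> \<int>" if t: "t \<in> {0..1}" for t
  proof -
    obtain i where i: "i < length ws" "real i \<le> \<psi> t" "\<psi> t \<le> real i + 1"
      using unit_subinterval[of "\<psi> t" "length ws"] reparam_range[OF re t] ws by auto
    obtain i' where i': "i' < length ws'" "real i' \<le> \<psi>' t" "\<psi>' t \<le> real i' + 1"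
      using unit_subinterval[of "\<psi>' t" "length ws'"] reparam_range[OF re' t] ws' by auto
    have "(\<psi> t - real i) - (\<psi>' t - real i') \<in> \<int>"
      using meet[OF t i i'] by auto
    then have "((\<psi> t - real i) - (\<psi>' t - real i')) + (real i - real i') \<in> \<int>"
      by (rule Ints_add) simp
    then show ?thesis by simp
  qed
  have "continuous_on {0..1} (\<lambda>t. \<psi> t - \<psi>' t)"
    by (intro continuous_intros reparam_continuous[OF re] reparam_continuous[OF re'])
  then have "\<psi> t - \<psi>' t = \<psi> 0 - \<psi>' 0" if "t \<in> {0..1}" for t
    using integer_valued_continuous_constant[OF _ Ints that, where y = 0] by simp
  then have eq: "\<psi> t = \<psi>' t" if "t \<in> {0..1}" for t
    using that reparam_endpoints(1)[OF re] reparam_endpoints(1)[OF re'] by simp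
  show "\<psi> = \<psi>'"
    using eq re re' by (auto simp: reparam_iff intro: extensionalityI)
  have "real (length ws) = real (length ws')"
    using eq[of 1] reparam_endpoints(2)[OF re] reparam_endpoints(2)[OF re'] by simp
  then have len: "length ws = length ws'" by simp
  show "ws = ws'"
  proof (rule nth_equalityI[OF len])
    fix i assume i: "i < length ws"
    then have "real i + 1 / 2 \<in> {0..real (length ws)}" by auto
    then obtain t where t: "t \<in> {0..1}" "\<psi> t = real i + 1 / 2"
      using re unfolding reparam_iff by (metis imageE)
    then show "ws ! i = ws' ! i" using meet[OF t(1), of i i] eq[OF t(1)] i len by auto
  qed
qed

end

theorem theorem6:
  fixes T :: top_cat
    and P :: "real \<Rightarrow> real \<Rightarrow> (real \<Rightarrow> real) set"
    and lam :: "'i::wellorder"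
    and X :: "'i \<Rightarrow> 'a mdspace"
    and tr :: "'i \<Rightarrow> 'i \<Rightarrow> 'a \<Rightarrow> 'a"
    and dm :: "'i \<Rightarrow> nat"
    and g h :: "'i \<Rightarrow> (nat \<Rightarrow> real) globe \<Rightarrow> 'a"
    and \<gamma> :: "real \<Rightarrow> 'a"
  assumes "P = G_maps \<or> P = M_maps"
    and "cellular T P lam X tr dm g h"
    and "\<gamma> \<in> epaths (X lam)"
  shows "(\<exists>ps. is_decomposition P lam dm (ghat P lam tr dm h) \<gamma> ps) \<and>
    (\<forall>ps ps'. is_decomposition P lam dm (ghat P lam tr dm h) \<gamma> ps \<and>
        is_decomposition P lam dm (ghat P lam tr dm h) \<gamma> ps' \<longrightarrow>
      length ps = length ps' \<and>
      (\<forall>i<length ps. cell (ps ! i) = cell (ps' ! i) \<and> pnt (ps ! i) = pnt (ps' ! i)) \<and>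
      decomposition_reparam ps = decomposition_reparam ps' \<and>
      decomposition_reparam ps \<in> P 1 (real (length ps)))"
proof -
  obtain s where P: "P = reparam s"
    using assms(1) G_maps_eq_reparam M_maps_eq_reparam by blast
  interpret cellular_mdspace T s lam X tr dm g h
    using assms(2) unfolding P by unfold_locales
  have "\<exists>ps. is_decomposition P lam dm gh \<gamma> ps"
  proof -
    obtain ws \<psi> where ws: "ws \<noteq> []" "set ws \<subseteq> open_cells lam dm" and "\<psi> \<in> reparam s 1 (length ws)"
      "traces gh ws 1 \<psi> \<gamma>"
      using epath_decomposable[OF assms(3)] unfolding decomposable_def by blast
    moreover have "\<gamma> \<in> extensional {0..1}"
      using pre_mdspace[OF order_refl] assms(3) unfolding pre_mdspace_def by blast
    ultimately obtain ps where ps: "map letter ps = ws"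
      "\<forall>p\<in>set ps. rep p \<in> reparam s 1 1 \<and> len p > 0" "sum_list (map len ps) = 1"
      "composable (map (piece_path gh) ps)" "moore (map (piece_path gh) ps) = (1, \<gamma>)"
      using traces_decomposition[of ws gh 1 \<psi> \<gamma> s] by auto
    have "letter p \<in> open_cells lam dm" if "p \<in> set ps" for p
      using that ws(2) ps(1) by auto
    then show ?thesis
      using ps ws(1) unfolding is_decomposition_def P
      by (intro exI[of _ ps]) (force simp: open_cells_def Suc_le_eq)
  qed
  moreover have traced: "map letter ps \<noteq> [] \<and> set (map letter ps) \<subseteq> open_cells lam dm \<and>
      decomposition_reparam ps \<in> reparam s 1 (length (map letter ps)) \<and>
      traces gh (map letter ps) 1 (decomposition_reparam ps) \<gamma>"
    if "is_decomposition P lam dm gh \<gamma> ps" for ps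
  proof -
    have ps: "ps \<noteq> []" "\<forall>p\<in>set ps. rep p \<in> reparam s 1 1 \<and> len p > 0"
      "composable (map (piece_path gh) ps)" "sum_list (map len ps) = 1"
      "moore (map (piece_path gh) ps) = (1, \<gamma>)" "set (map letter ps) \<subseteq> open_cells lam dm"
      using that unfolding is_decomposition_def P by (auto simp: open_cells_def)
    show ?thesis
      using decomposition_traces[OF ps(1-3)] ps by (auto simp: decomposition_reparam_def)
  qed
  moreover have "length ps = length ps' \<and>
      (\<forall>i<length ps. cell (ps ! i) = cell (ps' ! i) \<and> pnt (ps ! i) = pnt (ps' ! i)) \<and>
      decomposition_reparam ps = decomposition_reparam ps' \<and>
      decomposition_reparam ps \<in> P 1 (real (length ps))"
    if "is_decomposition P lam dm gh \<gamma> ps" "is_decomposition P lam dm gh \<gamma> ps'" for ps ps'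
  proof -
    note t = traced[OF that(1)] traced[OF that(2)]
    have \<psi>: "decomposition_reparam ps = decomposition_reparam ps'"
      and eq: "map letter ps = map letter ps'"
      using traces_unique[of "map letter ps" "map letter ps'"] t by blast+
    have len: "length ps = length ps'" using eq by (rule map_eq_imp_length_eq)
    have "letter (ps ! i) = letter (ps' ! i)" if "i < length ps" for i
      using arg_cong[OF eq, of "\<lambda>xs. xs ! i"] that len by simp
    then show ?thesis using t \<psi> len unfolding P by simp
  qed
  ultimately show ?thesis unfolding P by blast
qed

end
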